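(* Let $X\subset S^{d-1}$ be a finite set and let $A'(X)=\{\langle x,y\rangle\mid x,y\in X,\ x\ne y\}=\{\alpha_1,\dots,\alpha_s\}$ (with $\alpha_1,\dots,\alpha_s$ distinct). Put $\alpha_0=1$ and $R_k=\{(x,y)\in X\times X\mid\langle x,y\rangle=\alpha_k\}$ for $0\le k\le s$. Assume that $(X,\{R_k\}_{k=0}^s)$ is a symmetric association scheme, with intersection numbers $p_{i,j}^k$. Let $I=\{i\in\{1,\dots,s\}\mid\alpha_i\neq-1\}$, and for $z\in X$ and $i\in I$ let $X_i(z)$ be the derived design defined in the context. Then for all $i,j\in I$: (1) for every $z\in X$, $A(X_i(z),X_j(z))=\{\alpha_{i,j}^k\mid 0\le k\le s,\ p_{i,j}^k\ne0,\ \alpha_{i,j}^k\neq\pm1\}$, where $\alpha_{i,j}^k=\dfrac{\alpha_k-\alpha_i\alpha_j}{\sqrt{(1-\alpha_i^2)(1-\alpha_j^2)}}$; (2) for every $z\in X$, $X_i(z)=X_j(z)$ or $X_i(z)\cap X_j(z)=\emptyset$, and $X_i(z)=-X_j(z)$ or $X_i(z)\cap(-X_j(z))=\emptyset$; moreover $\delta_{X_i(z),X_j(z)}$ and $\delta_{X_i(z),-X_j(z)}$ are independent of $z\in X$; (3) $X_i(z)$ has the same strength for all $z\in X$. Moreover, let $t_i$ ($i\in I$) be positive integers such that $X_i(z)$ is a spherical $t_i$-design in $S^{d-2}$ for all $z\in X$, and put $s_{i,j}=|A(X_i(z),X_j(z))|$ (independent of $z$ by (1)). For $z\in X$ and $x,y$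 in the unit sphere of $z^\perp$ put $p_{\alpha,\beta}^{j}(x,y)=|\{w\in X_j(z)\mid\langle x,w\rangle=\alpha,\ \langle y,w\rangle=\beta\}|$. Suppose that for every $i,j,k\in I$ one of the following holds: (i) $s_{i,j}+s_{j,k}-2\le t_j$; (ii) $s_{i,j}+s_{j,k}-3=t_j$, and for any $\gamma\in A(X_i(z),X_k(z))$ there exist $\alpha\in A(X_i(z),X_j(z))$, $\beta\in A(X_j(z),X_k(z))$ such that $p_{\alpha,\beta}^{j}(x,y)$ is independent of the choice of $z\in X$ and of $x\in X_i(z)$, $y\in X_k(z)$ with $\langle x,y\rangle=\gamma$; (iii) $s_{i,j}+s_{j,k}-4=t_j$, and for any $\gamma\in A(X_i(z),X_k(z))$ there exist $\alpha\ne\alpha'$ in $A(X_i(z),X_j(z))$ and $\beta\neq\beta'$ in $A(X_j(z),X_k(z))$ such that $p_{\alpha,\beta}^{j}(x,y)$, $p_{\alpha,\beta'}^{j}(x,y)$ and $p_{\alpha',\beta}^{j}(x,y)$ are independent of the choice of $z\in X$ and of $x\in X_i(z)$, $y\in X_k(z)$ with $\langle x,y\rangle=\gamma$. Then $(X,\{R_k\}_{k=0}^s)$ is a triply regular association scheme.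
   Context: $S^{d-1}$ is the unit sphere in $\mathbb{R}^d$ and $\langle\cdot,\cdot\rangle$ the standard inner product. For finite sets $Y,Z$ in a unit sphere, $A(Y,Z)=\{\langle x,y\rangle\mid x\in Y,\ y\in Z,\ x\neq\pm y\}$. $\delta_{A,B}$ is $1$ if $A=B$ and $0$ otherwise. Spherical design: for a positive integer $t$, a finite non-empty set $Y\subset S^{m-1}$ is a spherical $t$-design if the average over $Y$ of every real polynomial of degree at most $t$ equals its average over $S^{m-1}$ (with respect to the uniform measure). The strength of $Y$ is the $t$ such that $Y$ is a $t$-design but not a $(t+1)$-design. Derived designs: for $z\in X$ and $i$ with $\alpha_i\ne\pm1$, $X_i(z)$ is the orthogonal projection of $\{y\in X\mid\langle y,z\rangle=\alpha_i\}$ to $z^\perp=\{y\in\mathbb{R}^d\mid\langle y,z\rangle=0\}$, rescaled to lie in the unit sphere $S^{d-2}$ of $z^\perp$. (If $\langle x,z\rangle=\alpha_i$, $\langle y,z\rangle=\alpha_j$, $\langle x,y\rangle=\alpha_k$, then the rescaled projections of $x,y$ have inner product $\alpha_{i,j}^k$.) Symmetric association scheme: a finite set $X$ with a partition $\{R_k\}_{k=0}^s$ of $X\times X$ into symmetric relations, $R_0$ being the diagonal, such that for all $i,j,k$ the number $p_{i,j}^k=|\{w\in X\mid(x,w)\in R_i,(w,y)\in R_j\}|$ is independent of the choice of $(x,y)\in R_k$. It is triply regular if for all $i,j,k,l,m,n\in\{0,\dots,s\}$ and all $x,y,z\in X$ with $(x,y)\in R_i$, $(y,z)\in R_j$, $(z,x)\in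 R_k$, the number $|\{w\in X\mid(w,x)\in R_m,(w,y)\in R_n,(w,z)\in R_l\}|$ depends only on $i,j,k,l,m,n$ and not on $x,y,z$. *)

theory Defs
  imports "HOL-Analysis.Analysis" "HOL-Library.Disjoint_Sets"
begin

section \<open>Association schemes\<close>

definition symmetric_association_scheme ::
    "'a set \<Rightarrow> (nat \<Rightarrow> ('a \<times> 'a) set) \<Rightarrow> nat \<Rightarrow> bool" where
  "symmetric_association_scheme X R s \<longleftrightarrow>
     finite X \<and> inj_on R {..s} \<and> partition_on (X \<times> X) (R ` {..s}) \<and>
     (\<forall>k\<le>s. sym (R k)) \<and> R 0 = Id_on X \<and>
     (\<forall>i\<le>s. \<forall>j\<le>s. \<forall>k\<le>s. \<exists>p. \<forall>(x, y)\<in>R k.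
        card {w \<in> X. (x, w) \<in> R i \<and> (w, y) \<in> R j} = p)"

text \<open>The common value on \<^term>\<open>R k\<close>; meaningful for a scheme, where every class is non-empty.\<close>

definition intersection_number ::
    "'a set \<Rightarrow> (nat \<Rightarrow> ('a \<times> 'a) set) \<Rightarrow> nat \<Rightarrow> nat \<Rightarrow> nat \<Rightarrow> nat" where
  "intersection_number X R i j k =
     (THE p. \<forall>(x, y)\<in>R k. card {w \<in> X. (x, w) \<in> R i \<and> (w, y) \<in> R j} = p)"

definition triply_regular_scheme ::
    "'a set \<Rightarrow> (nat \<Rightarrow> ('a \<times> 'a) set) \<Rightarrow> nat \<Rightarrow> bool" where
  "triply_regular_scheme X R s \<longleftrightarrow>
     symmetric_association_scheme X R s \<and>
     (\<forall>i\<le>s. \<forall>j\<le>s. \<forall>k\<le>s. \<forall>l\<le>s. \<forall>m\<le>s. \<forall>n\<le>s. \<exists>N. \<forall>x\<in>X. \<forall>y\<in>X. \<forall>z\<in>X.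
        (x, y) \<in> R i \<and> (y, z) \<in> R j \<and> (z, x) \<in> R k \<longrightarrow>
        card {w \<in> X. (w, x) \<in> R m \<and> (w, y) \<in> R n \<and> (w, z) \<in> R l} = N)"

section \<open>Spherical designs\<close>

definition polynomial_of_degree_le :: "nat \<Rightarrow> (real ^ 'n \<Rightarrow> real) \<Rightarrow> bool" where
  "polynomial_of_degree_le t f \<longleftrightarrow>
     (\<exists>c :: ('n \<Rightarrow> nat) \<Rightarrow> real.
        f = (\<lambda>x. \<Sum>e | (\<Sum>i\<in>UNIV. e i) \<le> t. c e * (\<Prod>i\<in>UNIV. (x $ i) ^ e i)))"

definition orthonormal_basis_of :: "(real ^ 'n) set \<Rightarrow> (real ^ 'n) set \<Rightarrow> bool" where
  "orthonormal_basis_of V B \<longleftrightarrow>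
     pairwise orthogonal B \<and> (\<forall>b\<in>B. norm b = 1) \<and> span B = V"

text \<open>Lebesgue measure on a linear subspace, in coordinates with respect to an orthonormal basis
  (the choice of basis is immaterial). It is a Borel measure on the ambient space, concentrated
  on the subspace.\<close>

definition subspace_lborel :: "(real ^ 'n) set \<Rightarrow> (real ^ 'n) measure" where
  "subspace_lborel V =
     (let B = (SOME B. orthonormal_basis_of V B)
      in distr (\<Pi>\<^sub>M b\<in>B. lborel) borel (\<lambda>c. \<Sum>b\<in>B. c b *\<^sub>R b))"

text \<open>The uniform probability measure on the unit sphere of a non-zero subspace, as the radial
  projection of the normalised Lebesgue measure on the unit ball of that subspace.\<close>

definition uniform_sphere_measure :: "(real ^ 'n) set \<Rightarrow> (real ^ 'n) measure" where
  "uniform_sphere_measure V =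
     distr (uniform_measure (subspace_lborel V) (cball 0 1)) borel sgn"

text \<open>Designs in the unit sphere of a subspace \<^term>\<open>V\<close>. The polynomials of degree at most
  \<^term>\<open>t\<close> on \<^term>\<open>V\<close> are exactly the restrictions of those on the ambient space. For
  \<^term>\<open>t = (0::nat)\<close> every finite non-empty subset of the sphere qualifies, so that a set
  that is not a 1-design has strength 0.\<close>

definition spherical_design :: "(real ^ 'n) set \<Rightarrow> nat \<Rightarrow> (real ^ 'n) set \<Rightarrow> bool" where
  "spherical_design V t Y \<longleftrightarrow>
     finite Y \<and> Y \<noteq> {} \<and> Y \<subseteq> V \<inter> sphere 0 1 \<and>
     (\<forall>f. polynomial_of_degree_le t f \<longrightarrow>
        (\<Sum>y\<in>Y. f y) / real (card Y) = integral\<^sup>L (uniform_sphere_measure V) f)"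

definition has_strength :: "(real ^ 'n) set \<Rightarrow> (real ^ 'n) set \<Rightarrow> nat \<Rightarrow> bool" where
  "has_strength V Y t \<longleftrightarrow> spherical_design V t Y \<and> \<not> spherical_design V (t + 1) Y"

section \<open>Derived designs\<close>

definition perp :: "real ^ 'n \<Rightarrow> (real ^ 'n) set" where
  "perp z = {y. y \<bullet> z = 0}"

text \<open>For a unit vector \<^term>\<open>z\<close>, the orthogonal projection of \<^term>\<open>y\<close> to
  \<^term>\<open>perp z\<close> is \<^term>\<open>y - (y \<bullet> z) *\<^sub>R z\<close>.\<close>

definition derived_design :: "(real ^ 'n) set \<Rightarrow> real \<Rightarrow> real ^ 'n \<Rightarrow> (real ^ 'n) set" where
  "derived_design X a z = (\<lambda>y. sgn (y - (y \<bullet> z) *\<^sub>R z)) ` {y \<in> X. y \<bullet> z = a}"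

definition angle_set :: "(real ^ 'n) set \<Rightarrow> (real ^ 'n) set \<Rightarrow> real set" where
  "angle_set Y Z = {x \<bullet> y | x y. x \<in> Y \<and> y \<in> Z \<and> x \<noteq> y \<and> x \<noteq> - y}"

definition derived_angle :: "real \<Rightarrow> real \<Rightarrow> real \<Rightarrow> real" where
  "derived_angle a b c = (c - a * b) / sqrt ((1 - a\<^sup>2) * (1 - b\<^sup>2))"

definition kronecker :: "'a \<Rightarrow> 'a \<Rightarrow> nat" where
  "kronecker A B = (if A = B then 1 else 0)"

text \<open>The value of a function that is constant on the non-empty set \<^term>\<open>X\<close>.\<close>

definition common_value :: "'a set \<Rightarrow> ('a \<Rightarrow> 'b) \<Rightarrow> 'b" where
  "common_value X f = (THE v. \<forall>z\<in>X. f z = v)"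

definition joint_count ::
    "(real ^ 'n) set \<Rightarrow> real \<Rightarrow> real \<Rightarrow> real ^ 'n \<Rightarrow> real ^ 'n \<Rightarrow> nat" where
  "joint_count W a b x y = card {w \<in> W. x \<bullet> w = a \<and> y \<bullet> w = b}"

text \<open>Independence of \<^term>\<open>joint_count (D j z) a b x y\<close> both of \<^term>\<open>z\<close> and of the pair
  \<^term>\<open>x \<in> D i z\<close>, \<^term>\<open>y \<in> D k z\<close> with inner product \<^term>\<open>c\<close>.\<close>

definition joint_count_constant ::
    "(real ^ 'n) set \<Rightarrow> (nat \<Rightarrow> real ^ 'n \<Rightarrow> (real ^ 'n) set) \<Rightarrow>
     nat \<Rightarrow> nat \<Rightarrow> nat \<Rightarrow> real \<Rightarrow> real \<Rightarrow> real \<Rightarrow> bool" where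
  "joint_count_constant X D i j k c a b \<longleftrightarrow>
     (\<exists>N. \<forall>z\<in>X. \<forall>x\<in>D i z. \<forall>y\<in>D k z. x \<bullet> y = c \<longrightarrow> joint_count (D j z) a b x y = N)"

end

theory Submission
  imports Defs "HOL-Computational_Algebra.Polynomial"
begin

text \<open>All assertions compare what is seen from a point \<open>z\<close> of \<open>X\<close> with what is seen from another
  point \<open>z'\<close>. Since two points of \<open>X\<close> are related according to their inner product, the scheme
  axioms say that the number of \<open>w\<close> with prescribed inner products with \<open>x\<close> and \<open>y\<close> depends only on
  \<open>\<langle>x, y\<rangle>\<close>. Hence any configuration of at most three points, and any sum over one further point of a
  function of its inner products with two given points, can be transported from one base point to
  another (\<open>sum_transfer\<close>, \<open>point_transfer\<close>). Rescaled projections to \<open>z\<^sup>\<bottom>\<close> have inner products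
  that are functions of the inner products in \<open>X\<close>, so this gives the angle sets of derived designs
  and, because unit vectors are equal or opposite exactly when their inner product is \<open>1\<close> or \<open>-1\<close>,
  the dichotomies for derived designs and their antipodes (\<open>angle_set_Der\<close>, \<open>signed_Der_transfer\<close>).

  For the strength, a set \<open>Y\<close> on the sphere of \<open>z\<^sup>\<bottom>\<close> is a \<open>t\<close>-design if and only if the sums
  \<open>\<Sum>x, y \<in> Y. \<langle>x, y\<rangle> ^ m\<close> with \<open>m \<le> t\<close> have the values that they have on average for the uniform
  measure (\<open>spherical_design_iff_power_sums\<close>): the difference of the two, divided by \<open>\<bar>Y\<bar>\<^sup>2\<close>, is the
  squared distance between the moment tensors of \<open>Y\<close> and of the sphere. This needs that moments of the uniform measure
  depend only on Gram matrices (\<open>mixed_moment_Gram\<close>), that is, the rotation invariance of the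
  measure, which is inherited from Lebesgue measure on the whole space.

  For triple regularity, project \<open>x\<close>, \<open>y\<close> and \<open>w\<close> to \<open>z\<^sup>\<bottom>\<close>. A triple count becomes the number
  \<open>p \<alpha> \<beta>\<close> of points \<open>w\<close> of a derived design with \<open>\<langle>x, w\<rangle> = \<alpha>\<close> and \<open>\<langle>y, w\<rangle> = \<beta>\<close>, and one has to see
  that \<open>p \<alpha> \<beta>\<close> depends only on \<open>\<langle>x, y\<rangle>\<close> and not on the base point. The design property determines \<open>\<Sum>\<alpha> \<beta>. p \<alpha> \<beta> * \<alpha> ^ l * \<beta> ^ m\<close>
  for \<open>l + m \<le> t\<close>, and the values with \<open>\<alpha>\<close> or \<open>\<beta>\<close> equal to \<open>\<plusminus>1\<close> are determined by these dichotomies. So the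
  difference of two such arrays is annihilated by all polynomials of degree at most \<open>t\<close>. Products of
  linear factors isolate single entries, and under each of the three conditions all entries of the
  difference vanish (\<open>annihilated_zero_tensor\<close>, \<open>annihilated_zero_one_entry\<close>,
  \<open>annihilated_zero_three_entries\<close>). Triples in which some points coincide or are antipodal reduce to
  counts with respect to two points.\<close>

section \<open>Orthogonal transformations and Lebesgue measure\<close>

text \<open>The reflection in the hyperplane orthogonal to \<open>a - b\<close>. That it fixes every vector with equal
  inner products with \<open>a\<close> and \<open>b\<close> allows several vectors to be moved into place one after the other.\<close>

lemma orthogonal_map_swapping:
  fixes a b :: "real ^ 'n"
  assumes "norm a = norm b"
  obtains U where "orthogonal_transformation U" "U a = b" "\<And>c. c \<bullet> a = c \<bullet> b \<Longrightarrow> U c = c"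
proof (cases "a = b")
  case True
  then show thesis
    using that[of "\<lambda>x. x"] by (simp add: orthogonal_transformation_id)
next
  case False
  define v where "v = a - b"
  have vv: "v \<bullet> v \<noteq> 0"
    using False by (simp add: v_def)
  define U where "U x = x - (2 * (x \<bullet> v) / (v \<bullet> v)) *\<^sub>R v" for x
  have "linear U"
    by (rule linearI) (simp_all add: U_def inner_left_distrib algebra_simps add_divide_distrib)
  moreover have "U x \<bullet> U y = x \<bullet> y" for x y
    using vv by (simp add: U_def inner_diff_left inner_diff_right inner_commute field_simps)
  ultimately have "orthogonal_transformation U"
    by (simp add: orthogonal_transformation_def)
  moreover have "U a = b"
  proof -
    have "a \<bullet> a = b \<bullet> b"
      using assms by (simp add: norm_eq)
    then have "2 * (a \<bullet> v) = v \<bullet> v"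
      by (simp add: v_def inner_diff_left inner_diff_right inner_commute)
    then show ?thesis
      using vv by (simp add: U_def) (simp add: v_def)
  qed
  moreover have "U c = c" if "c \<bullet> a = c \<bullet> b" for c
    using that by (simp add: U_def v_def inner_diff_right)
  ultimately show thesis
    by (rule that)
qed

lemma orthogonal_map_of_equal_Gram:
  fixes x y z x' y' z' :: "real ^ 'n"
  assumes "norm z = norm z'" "norm x = norm x'" "norm y = norm y'"
    and "z \<bullet> x = z' \<bullet> x'" "z \<bullet> y = z' \<bullet> y'" "x \<bullet> y = x' \<bullet> y'"
  obtains U where "orthogonal_transformation U" "U z = z'" "U x = x'" "U y = y'"
proof -
  obtain F where F: "orthogonal_transformation F" "F z = z'"
    using orthogonal_map_swapping[OF assms(1)] by metis
  have inF: "F u \<bullet> F v = u \<bullet> v" for u v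
    using F(1) by (simp add: orthogonal_transformation_def)
  obtain G where G: "orthogonal_transformation G" "G (F x) = x'"
      "\<And>c. c \<bullet> F x = c \<bullet> x' \<Longrightarrow> G c = c"
    using orthogonal_map_swapping[of "F x" x'] assms(2) orthogonal_transformation_norm[OF F(1)]
    by metis
  have inG: "G u \<bullet> G v = u \<bullet> v" for u v
    using G(1) by (simp add: orthogonal_transformation_def)
  have Gz: "G z' = z'"
    using G(3)[of z'] inF[of z x] F(2) assms(4) by simp
  \<comment> \<open>A further reflection moves \<open>y\<close>; it fixes \<open>z'\<close> and \<open>x'\<close> because the inner products agree.\<close>
  obtain K where K: "orthogonal_transformation K" "K (G (F y)) = y'"
      "\<And>c. c \<bullet> G (F y) = c \<bullet> y' \<Longrightarrow> K c = c"
    using orthogonal_map_swapping[of "G (F y)" y'] assms(3)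
      orthogonal_transformation_norm[OF F(1)] orthogonal_transformation_norm[OF G(1)]
    by metis
  have "K z' = z'"
    using K(3)[of z'] inG[of z' "F y"] Gz inF[of z y] F(2) assms(5) by simp
  moreover have "K x' = x'"
    using K(3)[of x'] inG[of "F x" "F y"] G(2) inF[of x y] assms(6) by simp
  ultimately show thesis
    using that[of "K \<circ> (G \<circ> F)"] F G K Gz
    by (simp add: orthogonal_transformation_compose)
qed

lemma borel_measurable_orthogonal_transformation:
  fixes U :: "'a :: euclidean_space \<Rightarrow> 'a"
  assumes "orthogonal_transformation U"
  shows "U \<in> borel_measurable borel"
  using orthogonal_transformation_linear[OF assms]
  by (simp add: borel_measurable_continuous_onI linear_continuous_on linear_linear)

lemma nn_integral_lborel_translate_reflect:
  fixes f :: "'a :: euclidean_space \<Rightarrow> ennreal"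
  assumes [measurable]: "f \<in> borel_measurable borel" and "\<bar>c\<bar> = 1"
  shows "(\<integral>\<^sup>+x. f (t + c *\<^sub>R x) \<partial>lborel) = (\<integral>\<^sup>+x. f x \<partial>lborel)"
proof -
  have "c \<noteq> 0"
    using assms by auto
  then have "(\<integral>\<^sup>+x. f x \<partial>lborel) = (\<integral>\<^sup>+x. f x \<partial>density (distr lborel borel (\<lambda>x. t + c *\<^sub>R x)) (\<lambda>_. \<bar>c\<bar> ^ DIM('a)))"
    using lborel_affine[of c t] by simp
  also have "\<dots> = (\<integral>\<^sup>+x. f (t + c *\<^sub>R x) \<partial>lborel)"
    using assms by (simp add: nn_integral_density nn_integral_distr)
  finally show ?thesis ..
qed

text \<open>Uniqueness of Haar measure in miniature. With \<open>B\<close> the unit ball, the double integral of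
  \<open>indicator A (U y) * indicator B (U y - x)\<close> is evaluated in both orders. One order gives the volume
  of the preimage of \<open>A\<close> times the volume of \<open>B\<close>. The other, after a translation of \<open>y\<close>, gives the
  volume of \<open>A\<close> times the volume of the preimage of \<open>B\<close>, which is \<open>B\<close> itself.\<close>

lemma lborel_distr_orthogonal_transformation:
  fixes U :: "'a :: euclidean_space \<Rightarrow> 'a"
  assumes U: "orthogonal_transformation U"
  shows "distr lborel borel U = lborel"
proof (rule measure_eqI)
  fix A :: "'a set"
  assume "A \<in> sets (distr lborel borel U)"
  then have [measurable]: "A \<in> sets borel" by simp
  note [measurable] = borel_measurable_orthogonal_transformation[OF U]
  define B where "B = ball (0 :: 'a) 1"
  have [measurable]: "B \<in> sets borel"
    by (simp add: B_def)
  have UB: "U y \<in> B \<longleftrightarrow> y \<in> B" for y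
    using orthogonal_transformation_norm[OF U] by (simp add: B_def)
  have "(\<integral>\<^sup>+y. (\<integral>\<^sup>+x. indicator A (U y) * indicator B (U y - x) \<partial>lborel) \<partial>lborel)
      = (\<integral>\<^sup>+y. indicator A (U y) * emeasure lborel B \<partial>lborel)"
  proof (rule nn_integral_cong)
    fix y
    have "(\<integral>\<^sup>+x. indicator B (U y - x) \<partial>lborel) = emeasure lborel B"
      using nn_integral_lborel_translate_reflect[of "indicator B" "-1" "U y"] by simp
    then show "(\<integral>\<^sup>+x. indicator A (U y) * indicator B (U y - x) \<partial>lborel)
        = indicator A (U y) * emeasure lborel B"
      by (simp add: nn_integral_cmult)
  qed
  also have "\<dots> = emeasure (distr lborel borel U) A * emeasure lborel B"
  proof -
    have "(\<integral>\<^sup>+y. indicator A (U y) \<partial>lborel) = emeasure (distr lborel borel U) A"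
      by (simp add: nn_integral_indicator[symmetric] nn_integral_distr del: nn_integral_indicator)
    then show ?thesis
      by (simp add: nn_integral_multc)
  qed
  finally have 1: "(\<integral>\<^sup>+y. (\<integral>\<^sup>+x. indicator A (U y) * indicator B (U y - x) \<partial>lborel) \<partial>lborel)
      = emeasure (distr lborel borel U) A * emeasure lborel B" .
  have "(\<integral>\<^sup>+x. (\<integral>\<^sup>+y. indicator A (U y) * indicator B (U y - x) \<partial>lborel) \<partial>lborel)
      = (\<integral>\<^sup>+x. (\<integral>\<^sup>+y. indicator A (x + U y) * indicator B y \<partial>lborel) \<partial>lborel)"
  proof (rule nn_integral_cong)
    fix x
    obtain v where v: "U v = x"
      using orthogonal_transformation_surj[OF U] by (metis surjD)
    have "U (v + y) = x + U y" for y
      using v linear_add[OF orthogonal_transformation_linear[OF U]] by simp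
    then show "(\<integral>\<^sup>+y. indicator A (U y) * indicator B (U y - x) \<partial>lborel)
        = (\<integral>\<^sup>+y. indicator A (x + U y) * indicator B y \<partial>lborel)"
      using nn_integral_lborel_translate_reflect
        [of "\<lambda>y. indicator A (U y) * indicator B (U y - x)" 1 v]
      by (simp add: indicator_def UB)
  qed
  also have "\<dots> = (\<integral>\<^sup>+y. (\<integral>\<^sup>+x. indicator A (x + U y) * indicator B y \<partial>lborel) \<partial>lborel)"
    using lborel_pair.Fubini'[of "\<lambda>y x. indicator A (x + U y) * indicator B y"] by simp
  also have "\<dots> = (\<integral>\<^sup>+y. emeasure lborel A * indicator B y \<partial>lborel)"
  proof (rule nn_integral_cong)
    fix y
    have "(\<integral>\<^sup>+x. indicator A (x + U y) \<partial>lborel) = emeasure lborel A"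
      using nn_integral_lborel_translate_reflect[of "indicator A" 1 "U y"] by (simp add: add.commute)
    then show "(\<integral>\<^sup>+x. indicator A (x + U y) * indicator B y \<partial>lborel)
        = emeasure lborel A * indicator B y"
      by (simp add: nn_integral_multc)
  qed
  also have "\<dots> = emeasure lborel A * emeasure lborel B"
    by (simp add: nn_integral_cmult)
  finally have "emeasure (distr lborel borel U) A * emeasure lborel B
      = emeasure lborel A * emeasure lborel B"
    using lborel_pair.Fubini'[of "\<lambda>x y. indicator A (U y) * indicator B (U y - x)"] 1 by simp
  moreover have "emeasure lborel B \<noteq> 0" "emeasure lborel B \<noteq> \<infinity>"
  proof -
    have "measure lborel B > 0"
      unfolding B_def by (rule content_ball_pos) simp
    then show "emeasure lborel B \<noteq> 0"
      by (auto simp: measure_def)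
    show "emeasure lborel B \<noteq> \<infinity>"
      unfolding B_def using emeasure_bounded_finite[of "ball (0 :: 'a) 1"] by auto
  qed
  ultimately show "emeasure (distr lborel borel U) A = emeasure lborel A"
    by (simp add: ennreal_mult_cancel_left mult.commute[of _ "emeasure lborel B"])
qed simp

lemma orthonormal_basis_finite_card:
  assumes "orthonormal_basis_of V B"
  shows "finite B" "card B = dim V"
proof -
  have "0 \<notin> B"
    using assms unfolding orthonormal_basis_of_def by force
  then have "independent B"
    using assms pairwise_orthogonal_independent unfolding orthonormal_basis_of_def by blast
  then show "finite B" 
    by (rule independent_imp_finite)
  show "card B = dim V"
    using assms \<open>independent B\<close> unfolding orthonormal_basis_of_def
    by (metis dim_span_eq_card_independent)
qed

lemma inner_orthonormal:
  assumes "orthonormal_basis_of V B" "b \<in> B" "c \<in> B"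
  shows "b \<bullet> c = (if b = c then 1 else 0)"
  using assms unfolding orthonormal_basis_of_def pairwise_def orthogonal_def
  by (auto simp: norm_eq_1)

text \<open>In the standard basis this is the definition of Lebesgue measure; an orthogonal transformation
  carries the standard basis to \<open>C\<close>.\<close>

lemma lborel_PiM_orthonormal:
  fixes C :: "(real ^ 'n) set"
  assumes C: "orthonormal_basis_of UNIV C"
  shows "(\<Pi>\<^sub>M c\<in>C. lborel) = distr lborel (\<Pi>\<^sub>M c\<in>C. borel) (\<lambda>x. \<lambda>c\<in>C. x \<bullet> c)"
proof -
  interpret product_sigma_finite "\<lambda>c. lborel :: real measure"
    by standard
  have fin: "finite C" and cardC: "card C = card (Basis :: (real ^ 'n) set)"
    using orthonormal_basis_finite_card[OF C] by simp_all
  obtain g where g: "bij_betw g (Basis :: (real ^ 'n) set) C"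
    using finite_same_card_bij[OF finite_Basis fin] cardC by metis
  define U where "U x = (\<Sum>b\<in>Basis. (x \<bullet> b) *\<^sub>R g b)" for x :: "real ^ 'n"
  have gC: "g b \<in> C" if "b \<in> Basis" for b
    using g that by (auto simp: bij_betw_def)
  have gg: "g b \<bullet> g c = (if b = c then 1 else 0)" if "b \<in> Basis" "c \<in> Basis" for b c
    using inner_orthonormal[OF C gC gC] that g by (auto simp: bij_betw_def inj_on_def)
  have Ug: "U x \<bullet> g c = x \<bullet> c" if "c \<in> Basis" for x c
    unfolding U_def inner_sum_left using that by (simp add: gg if_distrib cong: if_cong)
  have "linear U"
    by (rule linearI) (simp_all add: U_def inner_left_distrib scaleR_left_distrib
        sum.distrib scaleR_right.sum)
  moreover have "U x \<bullet> U y = x \<bullet> y" for x y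
  proof -
    have "U x \<bullet> U y = (\<Sum>b\<in>Basis. (y \<bullet> b) * (U x \<bullet> g b))"
      by (subst (2) U_def) (simp add: inner_sum_right)
    also have "\<dots> = x \<bullet> y"
      by (simp add: Ug euclidean_inner[of x y] mult.commute)
    finally show ?thesis .
  qed
  ultimately have U: "orthogonal_transformation U"
    by (simp add: orthogonal_transformation_def)
  have "distr lborel (\<Pi>\<^sub>M c\<in>C. borel) (\<lambda>x. \<lambda>c\<in>C. x \<bullet> c) = PiM C (\<lambda>c. lborel)"
  proof (rule PiM_eqI[OF fin])
    show "sets (distr lborel (\<Pi>\<^sub>M c\<in>C. borel) (\<lambda>x. \<lambda>c\<in>C. x \<bullet> c)) = sets (\<Pi>\<^sub>M c\<in>C. lborel)"
      by (simp cong: sets_PiM_cong)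
    fix A :: "real ^ 'n \<Rightarrow> real set"
    assume A: "\<And>c. c \<in> C \<Longrightarrow> A c \<in> sets lborel"
    have PiA: "Pi\<^sub>E C A \<in> sets (\<Pi>\<^sub>M c\<in>C. borel)"
      using A fin by (intro sets_PiM_I_finite) auto
    have S: "{x. \<forall>c\<in>C. x \<bullet> c \<in> A c} \<in> sets borel"
    proof -
      have "{x \<in> space borel. \<forall>c\<in>C. x \<bullet> c \<in> A c} \<in> sets borel"
        using fin A by (intro sets.sets_Collect_finite_All) simp_all
      then show ?thesis by simp
    qed
    have meas: "U \<in> borel_measurable lborel"
      using borel_measurable_orthogonal_transformation[OF U] by simp
    have "emeasure (distr lborel (\<Pi>\<^sub>M c\<in>C. borel) (\<lambda>x. \<lambda>c\<in>C. x \<bullet> c)) (Pi\<^sub>E C A)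
        = emeasure lborel {x :: real ^ 'n. \<forall>c\<in>C. x \<bullet> c \<in> A c}"
      by (subst emeasure_distr[OF _ PiA]) (auto intro!: arg_cong[of _ _ "emeasure lborel"])
    also have "\<dots> = emeasure (distr lborel borel U) {x. \<forall>c\<in>C. x \<bullet> c \<in> A c}"
      by (simp add: lborel_distr_orthogonal_transformation[OF U])
    also have "\<dots> = emeasure lborel {x :: real ^ 'n. \<forall>b\<in>Basis. x \<bullet> b \<in> A (g b)}"
    proof -
      have "U -` {x. \<forall>c\<in>C. x \<bullet> c \<in> A c} = {x. \<forall>b\<in>Basis. x \<bullet> b \<in> A (g b)}"
        using g Ug by (auto simp: bij_betw_def)
      then show ?thesis
        using S meas by (simp add: emeasure_distr)
    qed
    also have "\<dots> = emeasure (\<Pi>\<^sub>M b\<in>Basis. lborel) (Pi\<^sub>E (Basis :: (real ^ 'n) set) (\<lambda>b. A (g b)))"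
    proof -
      have T: "{x :: real ^ 'n. \<forall>b\<in>Basis. x \<bullet> b \<in> A (g b)} \<in> sets borel"
      proof -
        have "{x \<in> space borel. \<forall>b\<in>(Basis :: (real ^ 'n) set). x \<bullet> b \<in> A (g b)} \<in> sets borel"
          using gC A by (intro sets.sets_Collect_finite_All) simp_all
        then show ?thesis by simp
      qed
      have "(\<lambda>f. \<Sum>b\<in>Basis. f b *\<^sub>R b) -` {x :: real ^ 'n. \<forall>b\<in>Basis. x \<bullet> b \<in> A (g b)}
          \<inter> space (\<Pi>\<^sub>M b\<in>Basis. lborel) = Pi\<^sub>E Basis (\<lambda>b. A (g b))"
        by (auto simp: space_PiM PiE_def Pi_def)
      then show ?thesis
        using T by (subst lborel_eq) (simp add: emeasure_distr)
    qed
    also have "\<dots> = (\<Prod>b\<in>Basis. emeasure lborel (A (g b)))"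
      using gC A by (intro emeasure_PiM) auto
    also have "\<dots> = (\<Prod>c\<in>C. emeasure lborel (A c))"
      by (rule prod.reindex_bij_betw[OF g])
    finally show "emeasure (distr lborel (\<Pi>\<^sub>M c\<in>C. borel) (\<lambda>x. \<lambda>c\<in>C. x \<bullet> c)) (Pi\<^sub>E C A)
        = (\<Prod>c\<in>C. emeasure lborel (A c))" .
  qed
  then show ?thesis by simp
qed

section \<open>The uniform measure on the unit sphere of a hyperplane\<close>

definition perp_proj :: "real ^ 'n \<Rightarrow> real ^ 'n \<Rightarrow> real ^ 'n" where
  "perp_proj z x = x - (x \<bullet> z) *\<^sub>R z"

lemma borel_measurable_perp_proj [measurable]: "perp_proj z \<in> borel_measurable borel"
  unfolding perp_proj_def by measurable

lemma perp_proj_in_perp: "norm z = 1 \<Longrightarrow> perp_proj z x \<in> perp z"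
  by (simp add: perp_proj_def perp_def inner_diff_left norm_eq_1)

lemma subspace_perp: "subspace (perp z)"
  by (rule subspaceI) (simp_all add: perp_def inner_add_left)

lemma orthonormal_basis_of_insert:
  fixes z :: "real ^ 'n"
  assumes B: "orthonormal_basis_of (perp z) B" and z: "norm z = 1"
  shows "orthonormal_basis_of UNIV (insert z B)" "z \<notin> B"
proof -
  have BV: "b \<bullet> z = 0" if "b \<in> B" for b
    using that B span_base unfolding orthonormal_basis_of_def perp_def by blast
  then show "z \<notin> B"
    using z by (auto simp: norm_eq_1)
  have "x \<in> span (insert z B)" for x
  proof -
    have "perp_proj z x \<in> span B"
      using B perp_proj_in_perp[OF z] by (simp add: orthonormal_basis_of_def)
    then show ?thesis
      unfolding span_insert by (auto simp: perp_proj_def)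
  qed
  then show "orthonormal_basis_of UNIV (insert z B)"
    using B BV z unfolding orthonormal_basis_of_def
    by (auto simp: pairwise_insert orthogonal_def inner_commute)
qed

text \<open>Thickening a set in the hyperplane by one unit in the direction of \<open>z\<close> does not change its
  measure. This replaces the arbitrarily chosen basis of the hyperplane by Lebesgue measure on the
  whole space, for which invariance under orthogonal transformations is available.\<close>

lemma emeasure_subspace_lborel_perp:
  fixes z :: "real ^ 'n"
  assumes z: "norm z = 1" and S [measurable]: "S \<in> sets borel"
  shows "emeasure (subspace_lborel (perp z)) S
    = emeasure lborel {x. x \<bullet> z \<in> {0..1} \<and> perp_proj z x \<in> S}"
proof -
  interpret product_sigma_finite "\<lambda>b. lborel :: real measure"
    by standard
  define B where "B = (SOME B. orthonormal_basis_of (perp z) B)"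
  have "\<exists>B. orthonormal_basis_of (perp z) B"
    using orthonormal_basis_subspace[OF subspace_perp[of z]] unfolding orthonormal_basis_of_def
    by metis
  then have B: "orthonormal_basis_of (perp z) B"
    unfolding B_def by (rule someI_ex)
  have fin: "finite B"
    by (rule orthonormal_basis_finite_card[OF B])
  have C: "orthonormal_basis_of UNIV (insert z B)" "z \<notin> B"
    using orthonormal_basis_of_insert[OF B z] by auto
  have proj: "perp_proj z x = (\<Sum>b\<in>B. (x \<bullet> b) *\<^sub>R b)" for x
  proof -
    have "perp_proj z x \<bullet> b = x \<bullet> b" if "b \<in> B" for b
      using inner_orthonormal[OF C(1), of z b] that C(2)
      by (auto simp: perp_proj_def inner_diff_left)
    then have "(\<Sum>b\<in>B. (x \<bullet> b) *\<^sub>R b) = (\<Sum>b\<in>B. (perp_proj z x \<bullet> b) *\<^sub>R b)"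
      by simp
    also have "\<dots> = perp_proj z x"
      using B fin perp_proj_in_perp[OF z] unfolding orthonormal_basis_of_def
      by (intro orthonormal_basis_expand) auto
    finally show ?thesis ..
  qed
  \<comment> \<open>The indicator function of the slab over \<open>S\<close>, in the coordinates given by \<open>insert z B\<close>.\<close>
  define F :: "(real ^ 'n \<Rightarrow> real) \<Rightarrow> ennreal" where
    "F c = indicator {0..1} (c z) * indicator S (\<Sum>b\<in>B. c b *\<^sub>R b)" for c
  have F: "F \<in> borel_measurable (\<Pi>\<^sub>M c\<in>insert z B. lborel)"
    unfolding F_def by measurable
  have "emeasure lborel {x. x \<bullet> z \<in> {0..1} \<and> perp_proj z x \<in> S}
      = (\<integral>\<^sup>+x. indicator {x. x \<bullet> z \<in> {0..1} \<and> perp_proj z x \<in> S} x \<partial>lborel)"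
    by (rule nn_integral_indicator[symmetric]) measurable
  also have "\<dots> = (\<integral>\<^sup>+x. F (\<lambda>c\<in>insert z B. x \<bullet> c) \<partial>lborel)"
    by (rule nn_integral_cong) (auto simp: F_def proj indicator_def restrict_def)
  also have "\<dots> = (\<integral>\<^sup>+c. F c \<partial>(\<Pi>\<^sub>M c\<in>insert z B. lborel))"
    unfolding lborel_PiM_orthonormal[OF C(1)] using F
    by (subst nn_integral_distr) (auto cong: measurable_cong_sets sets_PiM_cong)
  also have "\<dots> = (\<integral>\<^sup>+c. (\<integral>\<^sup>+y. F (c(z := y)) \<partial>lborel) \<partial>(\<Pi>\<^sub>M b\<in>B. lborel))"
    by (rule product_nn_integral_insert[OF fin C(2) F])
  also have "\<dots> = (\<integral>\<^sup>+c. indicator S (\<Sum>b\<in>B. c b *\<^sub>R b) \<partial>(\<Pi>\<^sub>M b\<in>B. lborel))"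
  proof (rule nn_integral_cong)
    fix c :: "real ^ 'n \<Rightarrow> real"
    have "(\<Sum>b\<in>B. (c(z := y)) b *\<^sub>R b) = (\<Sum>b\<in>B. c b *\<^sub>R b)" for y
      using C(2) by (intro sum.cong) auto
    then show "(\<integral>\<^sup>+y. F (c(z := y)) \<partial>lborel) = indicator S (\<Sum>b\<in>B. c b *\<^sub>R b)"
      by (simp add: F_def nn_integral_multc)
  qed
  also have "\<dots> = (\<integral>\<^sup>+x. indicator S x \<partial>subspace_lborel (perp z))"
    by (simp add: subspace_lborel_def B_def[symmetric] Let_def nn_integral_distr
        del: nn_integral_indicator)
  also have "\<dots> = emeasure (subspace_lborel (perp z)) S"
    by (rule nn_integral_indicator) (simp add: subspace_lborel_def Let_def)
  finally show ?thesis ..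
qed

lemma sets_subspace_lborel [simp, measurable_cong]: "sets (subspace_lborel V) = sets borel"
  and space_subspace_lborel [simp]: "space (subspace_lborel V) = UNIV"
  by (simp_all add: subspace_lborel_def Let_def)

lemma sets_uniform_sphere_measure [simp, measurable_cong]:
    "sets (uniform_sphere_measure V) = sets borel"
  and space_uniform_sphere_measure [simp]: "space (uniform_sphere_measure V) = UNIV"
  by (simp_all add: uniform_sphere_measure_def)

lemma borel_measurable_sgn_vec [measurable]: "(sgn :: real ^ 'n \<Rightarrow> real ^ 'n) \<in> borel_measurable borel"
  unfolding sgn_div_norm by measurable

lemma subspace_lborel_orthogonal_transformation:
  fixes U :: "real ^ 'n \<Rightarrow> real ^ 'n"
  assumes U: "orthogonal_transformation U" and z: "norm z = 1"
  shows "subspace_lborel (perp (U z)) = distr (subspace_lborel (perp z)) borel U"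
proof (rule measure_eqI)
  fix S assume "S \<in> sets (subspace_lborel (perp (U z)))"
  then have S [measurable]: "S \<in> sets borel" by simp
  note [measurable] = borel_measurable_orthogonal_transformation[OF U]
  have Uz: "norm (U z) = 1"
    using U z by (simp add: orthogonal_transformation_norm)
  have proj: "perp_proj (U z) (U x) = U (perp_proj z x)" for x
    using U orthogonal_transformation_linear[OF U]
    by (simp add: perp_proj_def orthogonal_transformation_def linear_diff linear_scale)
  have inn: "U x \<bullet> U z = x \<bullet> z" for x
    using U by (simp add: orthogonal_transformation_def)
  have "emeasure (subspace_lborel (perp (U z))) S
      = emeasure (distr lborel borel U) {x. x \<bullet> U z \<in> {0..1} \<and> perp_proj (U z) x \<in> S}"
    by (simp add: emeasure_subspace_lborel_perp[OF Uz] lborel_distr_orthogonal_transformation[OF U])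
  also have "\<dots> = emeasure lborel {x. x \<bullet> z \<in> {0..1} \<and> perp_proj z x \<in> U -` S}"
    by (subst emeasure_distr) (auto intro!: arg_cong[of _ _ "emeasure lborel"] simp: inn proj)
  also have "\<dots> = emeasure (subspace_lborel (perp z)) (U -` S)"
  proof -
    have "U -` S \<in> sets borel"
      using measurable_sets[of U borel borel S] by simp
    then show ?thesis
      by (simp add: emeasure_subspace_lborel_perp[OF z])
  qed
  finally show "emeasure (subspace_lborel (perp (U z))) S
      = emeasure (distr (subspace_lborel (perp z)) borel U) S"
    by (simp add: emeasure_distr)
qed simp

lemma emeasure_uniform_sphere_measure:
  assumes "S \<in> sets borel"
  shows "emeasure (uniform_sphere_measure V) S
    = emeasure (subspace_lborel V) (cball 0 1 \<inter> sgn -` S) / emeasure (subspace_lborel V) (cball 0 1)"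
proof -
  have "sgn -` S \<in> sets borel"
    using measurable_sets[OF borel_measurable_sgn_vec assms] by simp
  then show ?thesis
    using assms by (simp add: uniform_sphere_measure_def emeasure_distr)
qed

lemma uniform_sphere_measure_orthogonal_transformation:
  fixes U :: "real ^ 'n \<Rightarrow> real ^ 'n"
  assumes U: "orthogonal_transformation U" and z: "norm z = 1"
  shows "uniform_sphere_measure (perp (U z)) = distr (uniform_sphere_measure (perp z)) borel U"
proof (rule measure_eqI)
  fix S assume "S \<in> sets (uniform_sphere_measure (perp (U z)))"
  then have S [measurable]: "S \<in> sets borel" by simp
  note [measurable] = borel_measurable_orthogonal_transformation[OF U]
  have [measurable]: "U -` S \<in> sets borel" "sgn -` S \<in> sets borel"
    using measurable_sets[of U borel borel S] measurable_sets[OF borel_measurable_sgn_vec S] by auto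
  have "sgn (U x) = U (sgn x)" for x
    using orthogonal_transformation_linear[OF U]
    by (simp add: sgn_div_norm orthogonal_transformation_norm[OF U] linear_scale)
  then have "U -` (cball 0 1 \<inter> sgn -` S) = cball 0 1 \<inter> sgn -` U -` S" "U -` cball 0 1 = cball 0 1"
    by (auto simp: orthogonal_transformation_norm[OF U])
  then show "emeasure (uniform_sphere_measure (perp (U z))) S
      = emeasure (distr (uniform_sphere_measure (perp z)) borel U) S"
    by (simp add: emeasure_distr emeasure_uniform_sphere_measure
        subspace_lborel_orthogonal_transformation[OF U z])
qed simp

lemma emeasure_subspace_lborel_cball:
  fixes z :: "real ^ 'n"
  assumes z: "norm z = 1"
  shows "emeasure (subspace_lborel (perp z)) (cball 0 1) \<noteq> 0"
    and "emeasure (subspace_lborel (perp z)) (cball 0 1) < \<infinity>"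
proof -
  let ?T = "{x. x \<bullet> z \<in> {0..1} \<and> perp_proj z x \<in> cball 0 1}"
  have eq: "emeasure (subspace_lborel (perp z)) (cball 0 1) = emeasure lborel ?T"
    by (rule emeasure_subspace_lborel_perp[OF z]) simp
  have "?T \<subseteq> cball 0 2"
  proof
    fix x assume "x \<in> ?T"
    then have "norm (perp_proj z x) \<le> 1" "\<bar>x \<bullet> z\<bar> \<le> 1"
      by auto
    then have "norm (perp_proj z x + (x \<bullet> z) *\<^sub>R z) \<le> 2"
      using z by (intro norm_triangle_le) simp
    then show "x \<in> cball 0 2"
      by (simp add: perp_proj_def)
  qed
  then have "bounded ?T"
    by (rule bounded_subset[OF bounded_cball])
  then show "emeasure (subspace_lborel (perp z)) (cball 0 1) < \<infinity>"
    unfolding eq by (rule emeasure_bounded_finite)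
  let ?O = "{x. 0 < x \<bullet> z \<and> x \<bullet> z < 1 \<and> norm (perp_proj z x) < 1}"
  have "open ?O"
    unfolding perp_proj_def
    by (intro open_Collect_conj open_Collect_less continuous_on_inner continuous_on_norm
        continuous_on_diff continuous_on_scaleR continuous_on_const continuous_on_id)
  moreover have "z /\<^sub>R 2 \<in> ?O"
  proof -
    have "z \<bullet> z = 1"
      using z by (simp add: norm_eq_1)
    then have "(z /\<^sub>R 2) \<bullet> z = 1 / 2" "perp_proj z (z /\<^sub>R 2) = 0"
      by (simp_all add: perp_proj_def)
    then show ?thesis by simp
  qed
  ultimately obtain e where e: "e > 0" "ball (z /\<^sub>R 2) e \<subseteq> ?O"
    by (rule openE)
  have "emeasure lborel (ball (z /\<^sub>R 2) e) \<noteq> 0"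
  proof
    assume "emeasure lborel (ball (z /\<^sub>R 2) e) = 0"
    then have "measure lborel (ball (z /\<^sub>R 2) e) = 0"
      unfolding measure_def by simp
    then show False
      using content_ball_pos[OF e(1), of "z /\<^sub>R 2"] by linarith
  qed
  then have "0 < emeasure lborel (ball (z /\<^sub>R 2) e)"
    by (rule zero_less_iff_neq_zero[THEN iffD2])
  also have "\<dots> \<le> emeasure lborel ?T"
    using e(2) by (intro emeasure_mono) auto
  finally show "emeasure (subspace_lborel (perp z)) (cball 0 1) \<noteq> 0"
    unfolding eq by simp
qed

lemma finite_measure_uniform_sphere_measure:
  assumes "norm z = 1"
  shows "finite_measure (uniform_sphere_measure (perp z))"
    and "measure (uniform_sphere_measure (perp z)) UNIV = 1"
proof -
  have 1: "emeasure (uniform_sphere_measure (perp z)) UNIV = 1"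
    using emeasure_subspace_lborel_cball[OF assms]
    by (simp add: emeasure_uniform_sphere_measure ennreal_divide_self)
  then show "finite_measure (uniform_sphere_measure (perp z))"
    by (intro finite_measureI) simp
  show "measure (uniform_sphere_measure (perp z)) UNIV = 1"
    using 1 by (simp add: measure_def)
qed

text \<open>A nonzero \<open>v\<close> orthogonal to \<open>z\<close> excludes dimension one, where the hyperplane is \<open>{0}\<close> and the
  measure sits at the origin. In general the set of points that are sent to \<open>0\<close> is the line through
  \<open>z\<close>, a null set because it lies in the hyperplane orthogonal to \<open>v\<close>.\<close>

lemma AE_uniform_sphere_measure_perp:
  fixes z v :: "real ^ 'n"
  assumes z: "norm z = 1" and v: "v \<in> perp z" "v \<noteq> 0"
  shows "AE \<xi> in uniform_sphere_measure (perp z). \<xi> \<bullet> z = 0 \<and> norm \<xi> = 1"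
proof -
  define S where "S = {x. \<not> (x \<bullet> z = 0 \<and> x \<noteq> 0)}"
  have S: "S \<in> sets borel"
  proof -
    have "S = - {x. z \<bullet> x = 0} \<union> {0}"
      by (auto simp: S_def inner_commute)
    moreover have "closed {x. z \<bullet> x = 0}"
      by (rule closed_hyperplane)
    ultimately show ?thesis
      by (simp add: borel_closed)
  qed
  let ?T = "{x. x \<bullet> z \<in> {0..1} \<and> perp_proj z x \<in> S}"
  have "?T \<subseteq> {x. v \<bullet> x = 0}"
  proof
    fix x assume "x \<in> ?T"
    moreover have "perp_proj z x \<bullet> z = 0"
      using perp_proj_in_perp[OF z, of x] by (simp add: perp_def)
    ultimately have "perp_proj z x = 0"
      by (simp add: S_def)
    moreover have "v \<bullet> perp_proj z x = v \<bullet> x"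
      using v(1) by (simp add: perp_proj_def perp_def inner_diff_right)
    ultimately show "x \<in> {x. v \<bullet> x = 0}"
      by simp
  qed
  then have "emeasure lborel ?T \<le> emeasure lborel {x. v \<bullet> x = 0}"
    by (rule emeasure_mono) (simp add: borel_closed closed_hyperplane)
  moreover have "{x. v \<bullet> x = 0} \<in> null_sets lborel"
  proof -
    have "{x. v \<bullet> x = 0} \<in> null_sets lebesgue"
      using negligible_hyperplane[of v 0] v(2) by (simp add: negligible_iff_null_sets)
    then show ?thesis
      by (simp add: null_sets_completion_iff borel_closed closed_hyperplane)
  qed
  ultimately have "emeasure (subspace_lborel (perp z)) S = 0"
    by (simp add: emeasure_subspace_lborel_perp[OF z S] null_sets_def)
  then have "S \<in> null_sets (subspace_lborel (perp z))"
    using S by (simp add: null_sets_def)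
  then have "AE x in subspace_lborel (perp z). x \<bullet> z = 0 \<and> x \<noteq> 0"
    by (rule AE_I') (auto simp: S_def)
  then have "AE x in subspace_lborel (perp z). x \<in> cball 0 1 \<longrightarrow> sgn x \<bullet> z = 0 \<and> norm (sgn x) = 1"
    by (rule AE_mp) (simp add: sgn_div_norm)
  then have "AE x in uniform_measure (subspace_lborel (perp z)) (cball 0 1).
      sgn x \<bullet> z = 0 \<and> norm (sgn x) = 1"
    by (rule AE_uniform_measureI[rotated]) simp
  then show ?thesis
    unfolding uniform_sphere_measure_def by (subst AE_distr_iff) simp_all
qed

section \<open>Designs in terms of moments and power sums of inner products\<close>

text \<open>Words of length \<open>m\<close> index the coordinates of the \<open>m\<close>-th tensor power of a vector: the tensor
  power of \<open>x\<close> has the coordinate \<open>word_monomial w x\<close> at \<open>w\<close>. Every monomial occurs, with a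
  multiplicity that turns the tensor inner product into a power of the inner product.\<close>

definition word_monomial :: "'n list \<Rightarrow> real ^ 'n \<Rightarrow> real" where
  "word_monomial w x = prod_list (map (\<lambda>i. x $ i) w)"

lemma finite_words: "finite {w :: 'n :: finite list. length w = m}"
  using finite_lists_length_eq[of "UNIV :: 'n set" m] by simp

lemma sum_word_monomials:
  fixes x y :: "real ^ 'n"
  shows "(\<Sum>w | length w = m. word_monomial w x * word_monomial w y) = (x \<bullet> y) ^ m"
proof (induction m)
  case 0
  then show ?case by (simp add: word_monomial_def)
next
  case (Suc m)
  let ?W = "{w :: 'n list. length w = m}"
  have "{w :: 'n list. length w = Suc m} = (\<lambda>(i, w). i # w) ` (UNIV \<times> ?W)"
    by (auto simp: length_Suc_conv image_iff)
  moreover have "inj_on (\<lambda>(i, w). i # w) (UNIV \<times> ?W)"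
    by (auto simp: inj_on_def)
  ultimately have "(\<Sum>w | length w = Suc m. word_monomial w x * word_monomial w y)
      = (\<Sum>(i, w)\<in>UNIV \<times> ?W. (x $ i * y $ i) * (word_monomial w x * word_monomial w y))"
    by (simp add: sum.reindex word_monomial_def case_prod_unfold mult_ac)
  also have "\<dots> = (\<Sum>i\<in>UNIV. x $ i * y $ i) * (x \<bullet> y) ^ m"
    by (simp add: Suc.IH[symmetric] sum_product sum.cartesian_product)
  finally show ?case
    by (simp add: inner_vec_def)
qed

lemma word_monomial_eq_prod_power:
  "word_monomial w x = (\<Prod>i\<in>UNIV. (x $ i) ^ count_list w i)"
proof (induction w)
  case Nil
  then show ?case by (simp add: word_monomial_def)
next
  case (Cons a w)
  have "(\<Prod>i\<in>UNIV. (x $ i) ^ count_list (a # w) i)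
      = (\<Prod>i\<in>UNIV. (if i = a then x $ i else 1) * (x $ i) ^ count_list w i)"
    by (intro prod.cong) auto
  also have "\<dots> = x $ a * word_monomial w x"
    by (simp add: prod.distrib Cons.IH)
  finally show ?case
    by (simp add: word_monomial_def)
qed

lemma sum_count_list_UNIV: "(\<Sum>i\<in>UNIV. count_list w i) = length (w :: 'n :: finite list)"
  using sum_count_set[of w UNIV] by simp

lemma word_with_counts:
  fixes e :: "'n :: finite \<Rightarrow> nat"
  obtains w where "count_list w = e"
proof -
  have "\<exists>w. count_list w = e" if "(\<Sum>i\<in>UNIV. e i) = m" for m and e :: "'n \<Rightarrow> nat"
    using that
  proof (induction m arbitrary: e)
    case 0
    then have "count_list [] = e"
      using sum_eq_0_iff[of UNIV e] by (auto simp: fun_eq_iff)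
    then show ?case by blast
  next
    case (Suc m)
    then obtain i where i: "e i > 0"
      by (metis nat.distinct(1) not_gr_zero sum.neutral)
    define e' where "e' = e(i := e i - 1)"
    have "(\<Sum>j\<in>UNIV. e j) = (\<Sum>j\<in>UNIV. e' j + (if j = i then 1 else 0))"
      using i by (intro sum.cong) (auto simp: e'_def)
    also have "\<dots> = (\<Sum>j\<in>UNIV. e' j) + 1"
      by (simp add: sum.distrib)
    finally obtain w where "count_list w = e'"
      using Suc by auto
    then have "count_list (i # w) = e"
      using i by (auto simp: e'_def fun_eq_iff)
    then show ?case by blast
  qed
  then show thesis
    using that by blast
qed

lemma finite_exponents: "finite {e :: 'n :: finite \<Rightarrow> nat. (\<Sum>i\<in>UNIV. e i) \<le> t}"
proof (rule finite_subset)
  show "{e :: 'n \<Rightarrow> nat. (\<Sum>i\<in>UNIV. e i) \<le> t} \<subseteq> (UNIV \<rightarrow>\<^sub>E {..t})"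
  proof (clarsimp simp: PiE_def Pi_def extensional_def)
    fix e :: "'n \<Rightarrow> nat" and i
    assume "(\<Sum>i\<in>UNIV. e i) \<le> t"
    then show "e i \<le> t"
      using member_le_sum[of i UNIV e] by simp
  qed
  show "finite ((UNIV :: 'n set) \<rightarrow>\<^sub>E {..t})"
    by (intro finite_PiE) auto
qed

lemma polynomial_word_monomial:
  fixes w :: "'n :: finite list"
  assumes "length w \<le> t"
  shows "polynomial_of_degree_le t (word_monomial w)"
proof -
  have eq: "word_monomial w x = (\<Sum>e | (\<Sum>i\<in>UNIV. e i) \<le> t.
      (if e = count_list w then 1 else 0) * (\<Prod>i\<in>UNIV. (x $ i) ^ e i))" for x
    using finite_exponents[where 'n = 'n, of t] assms
    by (simp add: word_monomial_eq_prod_power sum_count_list_UNIV if_distrib[of "\<lambda>a. a * _"] cong: if_cong)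
  show ?thesis
    unfolding polynomial_of_degree_le_def
    by (intro exI[of _ "\<lambda>e. if e = count_list w then 1 else 0"] ext eq)
qed

lemma abs_word_monomial_le: "norm x \<le> 1 \<Longrightarrow> \<bar>word_monomial w x\<bar> \<le> 1"
proof (induction w)
  case (Cons i w)
  have "\<bar>x $ i\<bar> \<le> 1"
    using component_le_norm_cart[of x i] Cons.prems by linarith
  then show ?case
    using Cons by (simp add: word_monomial_def abs_mult mult_le_one)
qed (simp add: word_monomial_def)

lemma borel_measurable_word_monomial [measurable]: "word_monomial w \<in> borel_measurable borel"
  unfolding word_monomial_eq_prod_power by measurable

lemma integrable_word_monomial:
  fixes z v :: "real ^ 'n"
  assumes "norm z = 1" "v \<in> perp z" "v \<noteq> 0"
  shows "integrable (uniform_sphere_measure (perp z)) (word_monomial w)"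
proof (rule finite_measure.integrable_const_bound)
  show "finite_measure (uniform_sphere_measure (perp z))"
    by (rule finite_measure_uniform_sphere_measure[OF assms(1)])
  show "AE \<xi> in uniform_sphere_measure (perp z). norm (word_monomial w \<xi>) \<le> 1"
    by (rule AE_mp[OF AE_uniform_sphere_measure_perp[OF assms]]) (simp add: abs_word_monomial_le)
qed simp

lemma spherical_design_iff_word_monomials:
  fixes z v :: "real ^ 'n"
  assumes "norm z = 1" "v \<in> perp z" "v \<noteq> 0"
  shows "spherical_design (perp z) t Y \<longleftrightarrow>
    finite Y \<and> Y \<noteq> {} \<and> Y \<subseteq> perp z \<inter> sphere 0 1 \<and>
    (\<forall>w. length w \<le> t \<longrightarrow> (\<Sum>y\<in>Y. word_monomial w y) / real (card Y)
        = integral\<^sup>L (uniform_sphere_measure (perp z)) (word_monomial w))"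
    (is "_ \<longleftrightarrow> ?Y \<and> ?words")
proof -
  let ?avg = "\<lambda>f. (\<Sum>y\<in>Y. f y) / real (card Y)"
  let ?\<sigma> = "uniform_sphere_measure (perp z)"
  have "?avg f = integral\<^sup>L ?\<sigma> f" if words: ?words and f: "polynomial_of_degree_le t f" for f
  proof -
    obtain c where c: "f = (\<lambda>x. \<Sum>e | (\<Sum>i\<in>UNIV. e i) \<le> t. c e * (\<Prod>i\<in>UNIV. (x $ i) ^ e i))"
      using f unfolding polynomial_of_degree_le_def by blast
    \<comment> \<open>Every monomial is the monomial of some word, whose length is its degree.\<close>
    obtain W :: "('n \<Rightarrow> nat) \<Rightarrow> 'n list" where W: "count_list (W e) = e" for e
      using word_with_counts by metis
    have f: "f = (\<lambda>x. \<Sum>e | (\<Sum>i\<in>UNIV. e i) \<le> t. c e * word_monomial (W e) x)"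
      unfolding c word_monomial_eq_prod_power W ..
    have len: "length (W e) = (\<Sum>i\<in>UNIV. e i)" for e
      using sum_count_list_UNIV[of "W e"] by (simp add: W)
    have "?avg f = (\<Sum>e | (\<Sum>i\<in>UNIV. e i) \<le> t. c e * ?avg (word_monomial (W e)))"
      unfolding f by (subst sum.swap) (simp add: sum_distrib_left sum_divide_distrib)
    also have "\<dots> = (\<Sum>e | (\<Sum>i\<in>UNIV. e i) \<le> t. c e * integral\<^sup>L ?\<sigma> (word_monomial (W e)))"
      using words by (intro sum.cong) (auto simp: len)
    also have "\<dots> = integral\<^sup>L ?\<sigma> f"
      unfolding f using integrable_word_monomial[OF assms] by (subst Bochner_Integration.integral_sum) auto
    finally show ?thesis .
  qed
  then show ?thesis
    unfolding spherical_design_def using polynomial_word_monomial by blast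
qed

lemma sum_power_inner_eq_sum_word_monomials:
  fixes x y \<xi> :: "real ^ 'n"
  shows "(x \<bullet> \<xi>) ^ l * (y \<bullet> \<xi>) ^ m = (\<Sum>(u, w)\<in>{u. length u = l} \<times> {w. length w = m}.
      word_monomial u x * word_monomial w y * word_monomial (u @ w) \<xi>)"
  unfolding sum_word_monomials[symmetric] sum_product sum.cartesian_product
  by (simp add: word_monomial_def mult_ac)

text \<open>The integrand is a combination of monomials of degree \<open>l + m\<close> in \<open>\<xi>\<close>.\<close>

lemma spherical_design_mixed_moment:
  fixes x y z :: "real ^ 'n"
  assumes z: "norm z = 1" and Y: "spherical_design (perp z) t Y" and "l + m \<le> t"
  shows "(\<Sum>\<xi>\<in>Y. (x \<bullet> \<xi>) ^ l * (y \<bullet> \<xi>) ^ m)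
    = real (card Y) * (\<integral>\<xi>. (x \<bullet> \<xi>) ^ l * (y \<bullet> \<xi>) ^ m \<partial>uniform_sphere_measure (perp z))"
proof -
  let ?\<sigma> = "uniform_sphere_measure (perp z)"
  let ?P = "{u :: 'n list. length u = l} \<times> {w :: 'n list. length w = m}"
  have Y': "finite Y" "Y \<noteq> {}" "Y \<subseteq> perp z \<inter> sphere 0 1"
    using Y by (auto simp: spherical_design_def)
  then obtain v where "v \<in> Y" by blast
  then have v: "v \<in> perp z" "v \<noteq> 0"
    using Y'(3) by force+
  have word: "(\<Sum>\<xi>\<in>Y. word_monomial w \<xi>) = real (card Y) * integral\<^sup>L ?\<sigma> (word_monomial w)"
    if "length w \<le> t" for w
    using Y Y' that unfolding spherical_design_iff_word_monomials[OF z v] by (auto simp: field_simps)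
  have "(\<Sum>\<xi>\<in>Y. (x \<bullet> \<xi>) ^ l * (y \<bullet> \<xi>) ^ m)
      = (\<Sum>(u, w)\<in>?P. word_monomial u x * word_monomial w y * (\<Sum>\<xi>\<in>Y. word_monomial (u @ w) \<xi>))"
    unfolding sum_power_inner_eq_sum_word_monomials
    by (subst sum.swap) (simp add: sum_distrib_left case_prod_unfold)
  also have "\<dots> = (\<Sum>(u, w)\<in>?P. word_monomial u x * word_monomial w y *
      (real (card Y) * integral\<^sup>L ?\<sigma> (word_monomial (u @ w))))"
    using assms(3) by (intro sum.cong) (auto simp: word)
  also have "\<dots> = real (card Y) * (\<Sum>(u, w)\<in>?P. word_monomial u x * word_monomial w y *
      integral\<^sup>L ?\<sigma> (word_monomial (u @ w)))"
    by (simp add: sum_distrib_left case_prod_unfold mult_ac)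
  also have "(\<Sum>(u, w)\<in>?P. word_monomial u x * word_monomial w y *
      integral\<^sup>L ?\<sigma> (word_monomial (u @ w))) = (\<integral>\<xi>. (x \<bullet> \<xi>) ^ l * (y \<bullet> \<xi>) ^ m \<partial>?\<sigma>)"
    unfolding sum_power_inner_eq_sum_word_monomials case_prod_unfold
    using integrable_word_monomial[OF z v] by (subst Bochner_Integration.integral_sum) auto
  finally show ?thesis .
qed

lemma mixed_moment_Gram:
  fixes x y z x' y' z' :: "real ^ 'n"
  assumes "norm z = 1" "norm z' = 1" "norm x = norm x'" "norm y = norm y'"
    and "z \<bullet> x = z' \<bullet> x'" "z \<bullet> y = z' \<bullet> y'" "x \<bullet> y = x' \<bullet> y'"
  shows "(\<integral>\<xi>. (x \<bullet> \<xi>) ^ l * (y \<bullet> \<xi>) ^ m \<partial>uniform_sphere_measure (perp z))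
    = (\<integral>\<xi>. (x' \<bullet> \<xi>) ^ l * (y' \<bullet> \<xi>) ^ m \<partial>uniform_sphere_measure (perp z'))"
proof -
  obtain U where U: "orthogonal_transformation U" "U z = z'" "U x = x'" "U y = y'"
    using orthogonal_map_of_equal_Gram[of z z' x x' y y'] assms by metis
  have inU: "U u \<bullet> U v = u \<bullet> v" for u v
    using U(1) by (simp add: orthogonal_transformation_def)
  note [measurable] = borel_measurable_orthogonal_transformation[OF U(1)]
  have "uniform_sphere_measure (perp z') = distr (uniform_sphere_measure (perp z)) borel U"
    using uniform_sphere_measure_orthogonal_transformation[OF U(1) assms(1)] U(2) by simp
  then show ?thesis
    by (simp add: integral_distr inU U(3,4)[symmetric])
qed

lemma moment_unit_vector:
  fixes z z' v v' :: "real ^ 'n"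
  assumes "norm z = 1" "norm z' = 1" "v \<in> perp z" "norm v = 1" "v' \<in> perp z'" "norm v' = 1"
  shows "(\<integral>\<xi>. (v \<bullet> \<xi>) ^ m \<partial>uniform_sphere_measure (perp z))
    = (\<integral>\<xi>. (v' \<bullet> \<xi>) ^ m \<partial>uniform_sphere_measure (perp z'))"
proof -
  have "z \<bullet> v = z' \<bullet> v'" "v \<bullet> v = v' \<bullet> v'"
    using assms by (auto simp: perp_def inner_commute norm_eq_1)
  then show ?thesis
    using mixed_moment_Gram[of z z' v v' v v' m 0] assms(1,2,4,6) by auto
qed

text \<open>Let \<open>a\<close> and \<open>b\<close> be the \<open>m\<close>-th moment tensors of the uniform distribution on \<open>Y\<close> and of the
  sphere. Both \<open>a \<bullet> b\<close> and \<open>b \<bullet> b\<close> are averages over unit vectors \<open>y\<close> of the \<open>m\<close>-th moment of the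
  sphere in the direction \<open>y\<close>, and this moment is the same for all \<open>y\<close>. Therefore the squared distance
  of \<open>a\<close> and \<open>b\<close> is \<open>a \<bullet> a\<close> minus that moment, and \<open>a \<bullet> a\<close> is the normalised power sum.\<close>

lemma spherical_design_iff_power_sums:
  fixes z v :: "real ^ 'n"
  assumes z: "norm z = 1" and v: "v \<in> perp z" "norm v = 1"
    and Y: "finite Y" "Y \<noteq> {}" "Y \<subseteq> perp z \<inter> sphere 0 1"
  shows "spherical_design (perp z) t Y \<longleftrightarrow>
    (\<forall>m\<le>t. (\<Sum>x\<in>Y. \<Sum>y\<in>Y. (x \<bullet> y) ^ m)
      = (real (card Y))\<^sup>2 * (\<integral>\<xi>. (v \<bullet> \<xi>) ^ m \<partial>uniform_sphere_measure (perp z)))"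
proof -
  let ?\<sigma> = "uniform_sphere_measure (perp z)"
  define n where "n = real (card Y)"
  have n: "n > 0"
    using Y by (simp add: n_def card_gt_0_iff)
  have v0: "v \<noteq> 0"
    using v(2) by auto
  note int = integrable_word_monomial[OF z v(1) v0]
  define a where "a w = (\<Sum>y\<in>Y. word_monomial w y) / n" for w
  define b where "b w = integral\<^sup>L ?\<sigma> (word_monomial w)" for w
  define c where "c m = (\<integral>\<xi>. (v \<bullet> \<xi>) ^ m \<partial>?\<sigma>)" for m
  have intb: "(\<Sum>w | length w = m. word_monomial w y * b w) = (\<integral>\<xi>. (y \<bullet> \<xi>) ^ m \<partial>?\<sigma>)" for y m
    unfolding sum_word_monomials[symmetric] b_def
    using int by (subst Bochner_Integration.integral_sum) auto
  have unit: "(\<Sum>w | length w = m. word_monomial w y * b w) = c m" if "y \<bullet> z = 0" "norm y = 1" for y m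
    unfolding intb c_def using that by (intro moment_unit_vector z v) (simp_all add: perp_def)
  have aa: "(\<Sum>w | length w = m. (a w)\<^sup>2) = (\<Sum>x\<in>Y. \<Sum>y\<in>Y. (x \<bullet> y) ^ m) / n\<^sup>2" for m
  proof -
    have "(\<Sum>w | length w = m. (a w)\<^sup>2)
        = (\<Sum>w | length w = m. \<Sum>x\<in>Y. \<Sum>y\<in>Y. word_monomial w x * word_monomial w y) / n\<^sup>2"
      by (simp add: a_def power2_eq_square sum_product sum_divide_distrib)
    also have "(\<Sum>w | length w = m. \<Sum>x\<in>Y. \<Sum>y\<in>Y. word_monomial w x * word_monomial w y)
        = (\<Sum>x\<in>Y. \<Sum>y\<in>Y. (x \<bullet> y) ^ m)"
    proof -
      have "(\<Sum>w | length w = m. \<Sum>x\<in>Y. \<Sum>y\<in>Y. word_monomial w x * word_monomial w y)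
          = (\<Sum>x\<in>Y. \<Sum>w | length w = m. \<Sum>y\<in>Y. word_monomial w x * word_monomial w y)"
        by (rule sum.swap)
      also have "\<dots> = (\<Sum>x\<in>Y. \<Sum>y\<in>Y. (x \<bullet> y) ^ m)"
        unfolding sum_word_monomials[symmetric] by (intro sum.cong refl sum.swap)
      finally show ?thesis .
    qed
    finally show ?thesis .
  qed
  have ab: "(\<Sum>w | length w = m. a w * b w) = c m" for m
  proof -
    have "(\<Sum>w | length w = m. a w * b w) = (\<Sum>w | length w = m. \<Sum>y\<in>Y. word_monomial w y * b w) / n"
      by (simp add: a_def sum_divide_distrib sum_distrib_right)
    also have "(\<Sum>w | length w = m. \<Sum>y\<in>Y. word_monomial w y * b w) = (\<Sum>y\<in>Y. c m)"
      unfolding sum.swap[of _ Y] using Y(3) by (intro sum.cong refl unit) (auto simp: perp_def)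
    finally show ?thesis
      using n by (simp add: n_def)
  qed
  have bb: "(\<Sum>w | length w = m. b w * b w) = c m" for m
  proof -
    have "(\<Sum>w | length w = m. b w * b w) = (\<integral>\<xi>. (\<Sum>w | length w = m. word_monomial w \<xi> * b w) \<partial>?\<sigma>)"
      using int by (subst Bochner_Integration.integral_sum) (auto simp: b_def)
    also have "\<dots> = (\<integral>\<xi>. c m \<partial>?\<sigma>)"
    proof (rule integral_cong_AE)
      show "AE \<xi> in ?\<sigma>. (\<Sum>w | length w = m. word_monomial w \<xi> * b w) = c m"
        by (rule AE_mp[OF AE_uniform_sphere_measure_perp[OF z v(1) v0]]) (simp add: unit)
    qed simp_all
    also have "\<dots> = c m"
      using finite_measure_uniform_sphere_measure(2)[OF z] by simp
    finally show ?thesis .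
  qed
  have dist: "(\<Sum>w | length w = m. (a w - b w)\<^sup>2) = (\<Sum>x\<in>Y. \<Sum>y\<in>Y. (x \<bullet> y) ^ m) / n\<^sup>2 - c m" for m
  proof -
    have "(\<Sum>w | length w = m. (a w - b w)\<^sup>2)
        = (\<Sum>w | length w = m. (a w)\<^sup>2) - 2 * (\<Sum>w | length w = m. a w * b w) + (\<Sum>w | length w = m. b w * b w)"
    proof -
      have "(a w - b w)\<^sup>2 = (a w)\<^sup>2 - 2 * (a w * b w) + b w * b w" for w
        by (simp add: power2_eq_square algebra_simps)
      then show ?thesis
        by (simp add: sum.distrib sum_subtractf sum_distrib_left)
    qed
    then show ?thesis
      by (simp add: aa ab bb)
  qed
  have "(\<forall>w. length w = m \<longrightarrow> a w = b w) \<longleftrightarrow> (\<Sum>x\<in>Y. \<Sum>y\<in>Y. (x \<bullet> y) ^ m) = n\<^sup>2 * c m" for m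
  proof -
    have "(\<forall>w. length w = m \<longrightarrow> a w = b w) \<longleftrightarrow> (\<Sum>w | length w = m. (a w - b w)\<^sup>2) = 0"
      using sum_nonneg_eq_0_iff[OF finite_words[of m], of "\<lambda>w. (a w - b w)\<^sup>2"] by simp
    also have "\<dots> \<longleftrightarrow> (\<Sum>x\<in>Y. \<Sum>y\<in>Y. (x \<bullet> y) ^ m) = n\<^sup>2 * c m"
      unfolding dist using n by (simp add: field_simps)
    finally show ?thesis .
  qed
  then have "(\<forall>m\<le>t. (\<Sum>x\<in>Y. \<Sum>y\<in>Y. (x \<bullet> y) ^ m) = n\<^sup>2 * c m)
      \<longleftrightarrow> (\<forall>w. length w \<le> t \<longrightarrow> a w = b w)"
    by metis
  then show ?thesis
    using Y by (simp add: spherical_design_iff_word_monomials[OF z v(1) v0] a_def b_def n_def c_def)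
qed

lemma spherical_design_transfer:
  fixes z z' :: "real ^ 'n"
  assumes z: "norm z = 1" "norm z' = 1"
    and Y: "finite Y" "Y \<noteq> {}" "Y \<subseteq> perp z \<inter> sphere 0 1"
    and Y': "finite Y'" "Y' \<noteq> {}" "Y' \<subseteq> perp z' \<inter> sphere 0 1"
    and card: "card Y = card Y'"
    and sums: "\<And>m. (\<Sum>x\<in>Y. \<Sum>y\<in>Y. (x \<bullet> y) ^ m) = (\<Sum>x\<in>Y'. \<Sum>y\<in>Y'. (x \<bullet> y) ^ m)"
  shows "spherical_design (perp z) t Y \<longleftrightarrow> spherical_design (perp z') t Y'"
proof -
  obtain v v' where v: "v \<in> perp z" "norm v = 1" and v': "v' \<in> perp z'" "norm v' = 1"
    using Y(2,3) Y'(2,3) by fastforce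
  have "(\<integral>\<xi>. (v \<bullet> \<xi>) ^ m \<partial>uniform_sphere_measure (perp z))
      = (\<integral>\<xi>. (v' \<bullet> \<xi>) ^ m \<partial>uniform_sphere_measure (perp z'))" for m
    by (rule moment_unit_vector[OF z v v'])
  then show ?thesis
    by (simp add: spherical_design_iff_power_sums[OF z(1) v Y]
        spherical_design_iff_power_sums[OF z(2) v' Y'] card sums)
qed

section \<open>Arrays that annihilate polynomials of low degree\<close>

definition annihilates_moments :: "nat \<Rightarrow> real set \<Rightarrow> real set \<Rightarrow> (real \<Rightarrow> real \<Rightarrow> real) \<Rightarrow> bool" where
  "annihilates_moments t A B N \<longleftrightarrow>
     (\<forall>l m. l + m \<le> t \<longrightarrow> (\<Sum>a\<in>A. \<Sum>b\<in>B. N a b * (a ^ l * b ^ m)) = 0)"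

lemma annihilates_polynomials:
  assumes "annihilates_moments t A B N" "degree p + degree q \<le> t"
  shows "(\<Sum>a\<in>A. \<Sum>b\<in>B. N a b * (poly p a * poly q b)) = 0"
proof -
  let ?I = "{..degree p} \<times> {..degree q}"
  have "poly p a * poly q b = (\<Sum>(l, m)\<in>?I. coeff p l * coeff q m * (a ^ l * b ^ m))" for a b
    unfolding poly_altdef sum_product sum.cartesian_product by (simp add: mult_ac)
  then have "(\<Sum>a\<in>A. \<Sum>b\<in>B. N a b * (poly p a * poly q b))
      = (\<Sum>a\<in>A. \<Sum>b\<in>B. \<Sum>(l, m)\<in>?I. coeff p l * coeff q m * (N a b * (a ^ l * b ^ m)))"
    by (simp add: sum_distrib_left case_prod_unfold mult_ac)
  also have "\<dots> = (\<Sum>a\<in>A. \<Sum>(l, m)\<in>?I. \<Sum>b\<in>B. coeff p l * coeff q m * (N a b * (a ^ l * b ^ m)))"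
    unfolding case_prod_unfold by (intro sum.cong refl sum.swap)
  also have "\<dots> = (\<Sum>(l, m)\<in>?I. \<Sum>a\<in>A. \<Sum>b\<in>B. coeff p l * coeff q m * (N a b * (a ^ l * b ^ m)))"
    unfolding case_prod_unfold by (rule sum.swap)
  also have "\<dots> = (\<Sum>(l, m)\<in>?I. coeff p l * coeff q m * (\<Sum>a\<in>A. \<Sum>b\<in>B. N a b * (a ^ l * b ^ m)))"
    by (simp add: sum_distrib_left)
  also have "\<dots> = 0"
    using assms unfolding annihilates_moments_def by (intro sum.neutral) auto
  finally show ?thesis .
qed

text \<open>The product of the linear factors with roots in \<open>S\<close> and in \<open>T\<close> is a polynomial of degree at
  most \<open>t\<close> that vanishes at all entries outside the complementary rectangle. If \<open>(a, b)\<close> is the only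
  entry of that rectangle that could be nonzero, it is the only term of the annihilated sum.\<close>

lemma annihilated_entry_zero:
  assumes ann: "annihilates_moments t A B N" and fin: "finite A" "finite B"
    and S: "S \<subseteq> A" "T \<subseteq> B" "card S + card T \<le> t"
    and ab: "a \<in> A - S" "b \<in> B - T"
    and others: "\<And>x y. x \<in> A - S \<Longrightarrow> y \<in> B - T \<Longrightarrow> (x, y) \<noteq> (a, b) \<Longrightarrow> N x y = 0"
  shows "N a b = 0"
proof -
  define r where "r S = (\<Prod>s\<in>S. [:- s, 1:])" for S :: "real set"
  have poly_r: "poly (r S) x = (\<Prod>s\<in>S. x - s)" for S x
    by (simp add: r_def poly_prod)
  have degree_r: "degree (r S) \<le> card S" for S
    unfolding r_def using degree_prod_sum_le[of S "\<lambda>s. [:- s, 1:]"]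
    by (cases "finite S") auto
  have finST: "finite S" "finite T"
    using S fin finite_subset by auto
  let ?f = "\<lambda>x y. N x y * (poly (r S) x * poly (r T) y)"
  have "degree (r S) + degree (r T) \<le> t"
    using degree_r[of S] degree_r[of T] S(3) by linarith
  then have "0 = (\<Sum>x\<in>A. \<Sum>y\<in>B. ?f x y)"
    using annihilates_polynomials[OF ann] by simp
  also have "\<dots> = (\<Sum>(x, y)\<in>A \<times> B. ?f x y)"
    by (rule sum.cartesian_product)
  also have "\<dots> = (\<Sum>(x, y)\<in>{(a, b)}. ?f x y)"
  proof (rule sum.mono_neutral_right)
    show "\<forall>i\<in>A \<times> B - {(a, b)}. (case i of (x, y) \<Rightarrow> ?f x y) = 0"
    proof
      fix i assume "i \<in> A \<times> B - {(a, b)}"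
      then obtain x y where i: "i = (x, y)" and xy: "x \<in> A" "y \<in> B" "(x, y) \<noteq> (a, b)"
        by auto
      have "?f x y = 0"
      proof (cases "x \<in> S \<or> y \<in> T")
        case True
        then show ?thesis
          using finST by (auto simp: poly_r)
      next
        case False
        then show ?thesis
          using xy others by simp
      qed
      then show "(case i of (x, y) \<Rightarrow> ?f x y) = 0"
        by (simp add: i)
    qed
  qed (use fin ab in auto)
  finally have "?f a b = 0" by simp
  moreover have "poly (r S) a \<noteq> 0" "poly (r T) b \<noteq> 0"
    using ab finST by (auto simp: poly_r)
  ultimately show ?thesis by simp
qed

lemma card_remove1:
  assumes "finite S" "u \<in> S"
  shows "card (S - {u}) = card S - 1" "card S \<ge> 1"
  using assms by (auto simp: Suc_le_eq card_gt_0_iff)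

lemma card_remove2:
  assumes "finite S" "u \<in> S" "v \<in> S" "u \<noteq> v"
  shows "card (S - {u, v}) = card S - 2" "card S \<ge> 2"
  using assms card_mono[of S "{u, v}"] by (auto simp: card_Diff_subset)

lemma card_remove3:
  assumes "finite S" "u \<in> S" "v \<in> S" "w \<in> S" "u \<noteq> v" "u \<noteq> w" "v \<noteq> w"
  shows "card (S - {u, v, w}) = card S - 3" "card S \<ge> 3"
  using assms card_mono[of S "{u, v, w}"] by (auto simp: card_Diff_subset)

lemma annihilated_zero_tensor:
  assumes ann: "annihilates_moments t A B N" and fin: "finite A" "finite B"
    and card: "int (card A) + int (card B) - 2 \<le> int t"
    and xy: "x \<in> A" "y \<in> B"
  shows "N x y = 0"
proof (rule annihilated_entry_zero[OF ann fin, of "A - {x}" "B - {y}"])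
  show "card (A - {x}) + card (B - {y}) \<le> t"
    using card card_remove1[OF fin(1) xy(1)] card_remove1[OF fin(2) xy(2)] by linarith
qed (use xy in auto)

text \<open>The degree is one short of isolating an entry in one step, but two entries of a common row or
  column can be separated from all others. So the entry \<open>(a, b)\<close> forces its row to vanish, and each
  entry of this row forces its column to vanish.\<close>

lemma annihilated_zero_one_entry:
  assumes ann: "annihilates_moments t A B N" and fin: "finite A" "finite B"
    and card: "int (card A) + int (card B) - 3 = int t"
    and ab: "a \<in> A" "b \<in> B" "N a b = 0"
    and xy: "x \<in> A" "y \<in> B"
  shows "N x y = 0"
proof -
  have row: "N a v = 0" if "v \<in> B" for v
  proof (cases "v = b")
    case False
    show ?thesis
    proof (rule annihilated_entry_zero[OF ann fin, of "A - {a}" "B - {b, v}"])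
      show "card (A - {a}) + card (B - {b, v}) \<le> t"
        using card card_remove1[of A a] card_remove2[of B b v] fin ab that False by auto
    qed (use ab that False in auto)
  qed (use ab in simp)
  show ?thesis
  proof (cases "x = a")
    case False
    show ?thesis
    proof (rule annihilated_entry_zero[OF ann fin, of "A - {a, x}" "B - {y}"])
      show "card (A - {a, x}) + card (B - {y}) \<le> t"
        using card card_remove1[of B y] card_remove2[of A a x] fin ab xy False by auto
    qed (use row ab xy False in auto)
  qed (use row xy in simp)
qed

text \<open>The available degree isolates three entries of a common row or column, or the four corners of a
  rectangle. Two known zeros in row \<open>a\<close> and two in column \<open>b\<close> make this row and this column vanish,
  and then they provide three corners of a rectangle for every other entry.\<close>

lemma annihilated_zero_three_entries:
  assumes ann: "annihilates_moments t A B N" and fin: "finite A" "finite B"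
    and card: "int (card A) + int (card B) - 4 = int t"
    and ab: "a \<in> A" "a' \<in> A" "b \<in> B" "b' \<in> B" "a \<noteq> a'" "b \<noteq> b'"
    and N: "N a b = 0" "N a b' = 0" "N a' b = 0"
    and xy: "x \<in> A" "y \<in> B"
  shows "N x y = 0"
proof -
  have row: "N a v = 0" if "v \<in> B" for v
  proof (cases "v = b \<or> v = b'")
    case False
    show ?thesis
    proof (rule annihilated_entry_zero[OF ann fin, of "A - {a}" "B - {b, b', v}"])
      show "card (A - {a}) + card (B - {b, b', v}) \<le> t"
        using card card_remove1[of A a] card_remove3[of B b b' v] fin ab that False by auto
    qed (use ab that False N in auto)
  qed (use N in auto)
  have column: "N u b = 0" if "u \<in> A" for u
  proof (cases "u = a \<or> u = a'")
    case False
    show ?thesis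
    proof (rule annihilated_entry_zero[OF ann fin, of "A - {a, a', u}" "B - {b}"])
      show "card (A - {a, a', u}) + card (B - {b}) \<le> t"
        using card card_remove1[of B b] card_remove3[of A a a' u] fin ab that False by auto
    qed (use ab that False N in auto)
  qed (use N in auto)
  show ?thesis
  proof (cases "x = a \<or> y = b")
    case False
    show ?thesis
    proof (rule annihilated_entry_zero[OF ann fin, of "A - {a, x}" "B - {b, y}"])
      show "card (A - {a, x}) + card (B - {b, y}) \<le> t"
        using card card_remove2[of A a x] card_remove2[of B b y] fin ab xy False by auto
    qed (use row column ab xy False in auto)
  qed (use row column xy in auto)
qed

section \<open>Rescaled projections of points\<close>

text \<open>The derived design of \<open>X\<close> at \<open>z\<close> consists of these points.\<close>

definition derived_point :: "real ^ 'n \<Rightarrow> real ^ 'n \<Rightarrow> real ^ 'n" where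
  "derived_point z y = sgn (perp_proj z y)"

lemma derived_design_eq_image: "derived_design X a z = derived_point z ` {y \<in> X. y \<bullet> z = a}"
  by (simp add: derived_design_def derived_point_def perp_proj_def)

lemma abs_inner_unit_le_1:
  fixes x y :: "real ^ 'n"
  assumes "norm x = 1" "norm y = 1"
  shows "\<bar>x \<bullet> y\<bar> \<le> 1"
  using Cauchy_Schwarz_ineq2[of x y] assms by simp

lemma inner_unit_eq_sign_iff:
  fixes x y :: "real ^ 'n"
  assumes "norm x = 1" "norm y = 1" "\<epsilon> \<in> {1, -1}"
  shows "x \<bullet> y = \<epsilon> \<longleftrightarrow> x = \<epsilon> *\<^sub>R y"
proof
  have "x \<bullet> x = 1" "y \<bullet> y = 1"
    using assms by (simp_all add: norm_eq_1)
  moreover assume "x \<bullet> y = \<epsilon>"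
  ultimately have "(x - \<epsilon> *\<^sub>R y) \<bullet> (x - \<epsilon> *\<^sub>R y) = 0"
    using assms(3) by (auto simp: inner_diff_left inner_diff_right inner_add_left inner_add_right inner_commute)
  then show "x = \<epsilon> *\<^sub>R y" by simp
next
  assume "x = \<epsilon> *\<^sub>R y"
  then show "x \<bullet> y = \<epsilon>"
    using assms(2) by (simp add: norm_eq_1)
qed

lemma norm_perp_proj:
  assumes "norm z = 1" "norm x = 1"
  shows "norm (perp_proj z x) = sqrt (1 - (x \<bullet> z)\<^sup>2)"
proof -
  have "x \<bullet> x = 1" "z \<bullet> z = 1"
    using assms by (simp_all add: norm_eq_1)
  then have "perp_proj z x \<bullet> perp_proj z x = 1 - (x \<bullet> z)\<^sup>2"
    by (simp add: perp_proj_def inner_diff_left inner_diff_right inner_commute[of z x] power2_eq_square)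
  then show ?thesis
    by (simp add: norm_eq_sqrt_inner)
qed

lemma one_minus_square_pos: "\<bar>a\<bar> < 1 \<Longrightarrow> 0 < 1 - a\<^sup>2" for a :: real
  by (simp add: abs_square_less_1)

lemma inner_derived_point:
  assumes "norm z = 1" "norm x = 1" "norm y = 1" "\<bar>x \<bullet> z\<bar> < 1" "\<bar>y \<bullet> z\<bar> < 1"
  shows "derived_point z x \<bullet> derived_point z y = derived_angle (x \<bullet> z) (y \<bullet> z) (x \<bullet> y)"
proof -
  have "perp_proj z x \<bullet> perp_proj z y = x \<bullet> y - (x \<bullet> z) * (y \<bullet> z)"
    using assms(1)
    by (simp add: perp_proj_def inner_diff_left inner_diff_right inner_commute[of z y] norm_eq_1)
  then show ?thesis
    using assms
    by (simp add: derived_point_def sgn_div_norm derived_angle_def norm_perp_proj real_sqrt_mult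
        divide_simps)
qed

lemma derived_point_perp: "norm z = 1 \<Longrightarrow> derived_point z x \<in> perp z"
  using perp_proj_in_perp[of z x] by (simp add: derived_point_def perp_def sgn_div_norm)

lemma norm_derived_point:
  assumes "norm z = 1" "norm x = 1" "\<bar>x \<bullet> z\<bar> < 1"
  shows "norm (derived_point z x) = 1"
proof -
  have "norm (perp_proj z x) \<noteq> 0"
    using one_minus_square_pos[OF assms(3)] by (simp add: norm_perp_proj[OF assms(1,2)])
  then show ?thesis
    by (simp add: derived_point_def norm_sgn)
qed

lemma derived_angle_eq_iff:
  assumes "\<bar>a\<bar> < 1" "\<bar>b\<bar> < 1"
  shows "derived_angle a b c = derived_angle a b c' \<longleftrightarrow> c = c'"
proof -
  have "sqrt ((1 - a\<^sup>2) * (1 - b\<^sup>2)) \<noteq> 0"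
    using one_minus_square_pos[OF assms(1)] one_minus_square_pos[OF assms(2)] by simp
  then show ?thesis
    by (simp add: derived_angle_def divide_cancel_right)
qed

lemma derived_angle_one: "\<bar>a\<bar> < 1 \<Longrightarrow> derived_angle a a 1 = 1"
  using one_minus_square_pos[of a] by (simp add: derived_angle_def power2_eq_square real_sqrt_mult)

lemma derived_point_inj_on:
  assumes z: "norm z = 1" and X: "X \<subseteq> sphere 0 1" and a: "\<bar>a\<bar> < 1"
  shows "inj_on (derived_point z) {y \<in> X. y \<bullet> z = a}"
proof (rule inj_onI)
  fix x y assume "x \<in> {y \<in> X. y \<bullet> z = a}" "y \<in> {y \<in> X. y \<bullet> z = a}"
  then have xy: "norm x = 1" "norm y = 1" "x \<bullet> z = a" "y \<bullet> z = a"
    using X by auto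
  assume "derived_point z x = derived_point z y"
  then have "derived_point z x \<bullet> derived_point z y = 1"
    using norm_derived_point[OF z xy(1)] xy(3) a by (simp add: norm_eq_1)
  then have "derived_angle a a (x \<bullet> y) = derived_angle a a 1"
    using inner_derived_point[OF z xy(1,2)] xy a by (simp add: derived_angle_one)
  then have "x \<bullet> y = 1"
    by (simp add: derived_angle_eq_iff[OF a a])
  then show "x = y"
    using inner_unit_eq_sign_iff[OF xy(1,2), of 1] by simp
qed

lemma sum_over_inner_products:
  fixes W :: "(real ^ 'n) set"
  assumes "finite W" "finite P" "finite Q" "\<And>w. w \<in> W \<Longrightarrow> x \<bullet> w \<in> P" "\<And>w. w \<in> W \<Longrightarrow> y \<bullet> w \<in> Q"
  shows "(\<Sum>w\<in>W. g (x \<bullet> w) (y \<bullet> w)) = (\<Sum>a\<in>P. \<Sum>b\<in>Q. real (joint_count W a b x y) * g a b)"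
proof -
  let ?h = "\<lambda>w. (x \<bullet> w, y \<bullet> w)"
  have "(\<Sum>w\<in>W. g (x \<bullet> w) (y \<bullet> w))
      = (\<Sum>ab\<in>P \<times> Q. \<Sum>w\<in>{w \<in> W. ?h w = ab}. g (x \<bullet> w) (y \<bullet> w))"
    using assms by (intro sum.group[symmetric]) auto
  also have "\<dots> = (\<Sum>(a, b)\<in>P \<times> Q. real (joint_count W a b x y) * g a b)"
    by (intro sum.cong refl) (auto simp: joint_count_def)
  also have "\<dots> = (\<Sum>a\<in>P. \<Sum>b\<in>Q. real (joint_count W a b x y) * g a b)"
    by (rule sum.cartesian_product[symmetric])
  finally show ?thesis .
qed

lemma joint_count_sign:
  fixes x y :: "real ^ 'n"
  assumes "norm x = 1" "\<And>w. w \<in> W \<Longrightarrow> norm w = 1" "\<epsilon> \<in> {1, -1}"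
  shows "joint_count W \<epsilon> b x y = (if \<epsilon> *\<^sub>R x \<in> W \<and> \<epsilon> * (y \<bullet> x) = b then 1 else 0)"
proof -
  have "x \<bullet> w = \<epsilon> \<longleftrightarrow> w = \<epsilon> *\<^sub>R x" if "w \<in> W" for w
    using inner_unit_eq_sign_iff[OF assms(2)[OF that] assms(1,3)] by (simp add: inner_commute)
  then have "{w \<in> W. x \<bullet> w = \<epsilon> \<and> y \<bullet> w = b} = {w \<in> W. w = \<epsilon> *\<^sub>R x \<and> y \<bullet> w = b}"
    by blast
  also have "\<dots> = (if \<epsilon> *\<^sub>R x \<in> W \<and> \<epsilon> * (y \<bullet> x) = b then {\<epsilon> *\<^sub>R x} else {})"
    by auto
  finally have "{w \<in> W. x \<bullet> w = \<epsilon> \<and> y \<bullet> w = b}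
      = (if \<epsilon> *\<^sub>R x \<in> W \<and> \<epsilon> * (y \<bullet> x) = b then {\<epsilon> *\<^sub>R x} else {})" .
  then show ?thesis
    by (simp add: joint_count_def)
qed

lemma joint_count_swap: "joint_count W a b x y = joint_count W b a y x"
  unfolding joint_count_def by (rule arg_cong[of _ _ card]) auto

section \<open>Schemes of inner products and their derived designs\<close>

text \<open>The scheme axioms without reference to indices: relations are replaced by the inner products that
  define them, and counts for arbitrary real numbers \<open>a\<close> and \<open>b\<close> are allowed, since they are zero
  when \<open>a\<close> or \<open>b\<close> is not an inner product of points of \<open>X\<close>.\<close>

locale inner_product_scheme =
  fixes X :: "(real ^ 'n) set"
  assumes finite_X: "finite X"
    and X_unit: "X \<subseteq> sphere 0 1"
    and joint_count_X: "\<And>x y x' y' a b. \<lbrakk>x \<in> X; y \<in> X; x' \<in> X; y' \<in> X; x \<bullet> y = x' \<bullet> y'\<rbrakk>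
      \<Longrightarrow> joint_count X a b x y = joint_count X a b x' y'"
begin

abbreviation Der :: "real \<Rightarrow> real ^ 'n \<Rightarrow> (real ^ 'n) set" where
  "Der \<equiv> derived_design X"

definition inner_products :: "real set" where
  "inner_products = {x \<bullet> y | x y. x \<in> X \<and> y \<in> X}"

lemma norm_X: "x \<in> X \<Longrightarrow> norm x = 1"
  using X_unit by auto

lemma finite_inner_products: "finite inner_products"
proof -
  have "inner_products = (\<lambda>(x, y). x \<bullet> y) ` (X \<times> X)"
    by (auto simp: inner_products_def)
  then show ?thesis
    using finite_X by simp
qed

lemma sum_transfer:
  assumes "x \<in> X" "y \<in> X" "x' \<in> X" "y' \<in> X" "x \<bullet> y = x' \<bullet> y'"
  shows "(\<Sum>w\<in>X. g (x \<bullet> w) (y \<bullet> w) :: real) = (\<Sum>w\<in>X. g (x' \<bullet> w) (y' \<bullet> w))"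
proof -
  have "(\<Sum>w\<in>X. g (x \<bullet> w) (y \<bullet> w)) = (\<Sum>a\<in>inner_products. \<Sum>b\<in>inner_products. real (joint_count X a b x y) * g a b)"
    if "x \<in> X" "y \<in> X" for x y
    using that by (intro sum_over_inner_products finite_X finite_inner_products)
      (auto simp: inner_products_def)
  then show ?thesis
    using assms joint_count_X[OF assms] by simp
qed

lemma card_transfer:
  assumes "x \<in> X" "y \<in> X" "x' \<in> X" "y' \<in> X" "x \<bullet> y = x' \<bullet> y'"
  shows "card {w \<in> X. P (x \<bullet> w) (y \<bullet> w)} = card {w \<in> X. P (x' \<bullet> w) (y' \<bullet> w)}"
proof -
  have *: "real (card {w \<in> X. P (x \<bullet> w) (y \<bullet> w)}) = (\<Sum>w\<in>X. if P (x \<bullet> w) (y \<bullet> w) then 1 else 0)" for x y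
    using finite_X by (simp add: sum.If_cases Int_def)
  have "real (card {w \<in> X. P (x \<bullet> w) (y \<bullet> w)}) = real (card {w \<in> X. P (x' \<bullet> w) (y' \<bullet> w)})"
    unfolding * by (rule sum_transfer[OF assms])
  then show ?thesis
    by (simp only: of_nat_eq_iff)
qed

text \<open>A count that is nonzero for \<open>(x, y)\<close> is nonzero for \<open>(x', y')\<close>.\<close>

lemma point_transfer:
  assumes "x \<in> X" "y \<in> X" "x' \<in> X" "y' \<in> X" "x \<bullet> y = x' \<bullet> y'" "w \<in> X"
  obtains w' where "w' \<in> X" "x' \<bullet> w' = x \<bullet> w" "y' \<bullet> w' = y \<bullet> w"
proof -
  have "card {v \<in> X. x \<bullet> v = x \<bullet> w \<and> y \<bullet> v = y \<bullet> w} \<noteq> 0"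
    using finite_X assms(6) by (auto simp: card_eq_0_iff)
  then have "card {v \<in> X. x' \<bullet> v = x \<bullet> w \<and> y' \<bullet> v = y \<bullet> w} \<noteq> 0"
    using card_transfer[OF assms(1-5), of "\<lambda>a b. a = x \<bullet> w \<and> b = y \<bullet> w"] by simp
  then show thesis
    using that by (auto simp: card_eq_0_iff)
qed

lemma in_Der_iff: "u \<in> Der a z \<longleftrightarrow> (\<exists>y\<in>X. y \<bullet> z = a \<and> u = derived_point z y)"
  by (auto simp: derived_design_eq_image)

lemma Der_subset:
  assumes "z \<in> X" "\<bar>a\<bar> < 1"
  shows "Der a z \<subseteq> perp z \<inter> sphere 0 1"
proof
  fix u assume "u \<in> Der a z"
  then obtain y where "y \<in> X" "y \<bullet> z = a" "u = derived_point z y"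
    by (auto simp: in_Der_iff)
  then show "u \<in> perp z \<inter> sphere 0 1"
    using derived_point_perp[of z y] norm_derived_point[of z y] norm_X assms by simp
qed

lemma finite_Der: "finite (Der a z)"
  using finite_X by (simp add: derived_design_eq_image)

lemma Der_nonempty:
  assumes "z \<in> X" "a \<in> inner_products"
  shows "Der a z \<noteq> {}"
proof -
  obtain x y where xy: "x \<in> X" "y \<in> X" "x \<bullet> y = a"
    using assms by (auto simp: inner_products_def)
  have "x \<bullet> x = z \<bullet> z"
    using norm_X xy(1) assms(1) by (simp add: dot_square_norm)
  then obtain w where "w \<in> X" "z \<bullet> w = x \<bullet> y"
    using point_transfer[OF xy(1) xy(1) assms(1) assms(1) _ xy(2)] by metis
  then have "derived_point z w \<in> Der a z"
    using xy(3) by (auto simp: in_Der_iff inner_commute)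
  then show ?thesis by blast
qed

lemma sum_Der:
  assumes "z \<in> X" "\<bar>a\<bar> < 1"
  shows "(\<Sum>u\<in>Der a z. h u) = (\<Sum>y | y \<in> X \<and> y \<bullet> z = a. h (derived_point z y))"
  unfolding derived_design_eq_image
  using derived_point_inj_on[OF norm_X[OF assms(1)] X_unit assms(2)] by (simp add: sum.reindex)

lemma inner_derived_point_X:
  assumes "x \<in> X" "y \<in> X" "z \<in> X" "x \<bullet> z = a" "y \<bullet> z = b" "\<bar>a\<bar> < 1" "\<bar>b\<bar> < 1"
  shows "derived_point z x \<bullet> derived_point z y = derived_angle a b (x \<bullet> y)"
  using inner_derived_point[of z x y] norm_X assms by auto

text \<open>The inner products of the points of \<open>Der c z\<close> with \<open>x\<close> are functions of inner products with the
  two points \<open>z\<close> and \<open>u\<close> of \<open>X\<close>, where \<open>u\<close> projects to \<open>x\<close>; and \<open>z \<bullet> u = e\<close> is the same for both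
  base points.\<close>

lemma sum_Der_transfer:
  assumes z: "z \<in> X" "z' \<in> X" and x: "x \<in> Der e z" "x' \<in> Der e z'" and e: "\<bar>e\<bar> < 1" and c: "\<bar>c\<bar> < 1"
  shows "(\<Sum>w\<in>Der c z. h (x \<bullet> w) :: real) = (\<Sum>w\<in>Der c z'. h (x' \<bullet> w))"
proof -
  obtain u u' where u: "u \<in> X" "u \<bullet> z = e" "x = derived_point z u"
      and u': "u' \<in> X" "u' \<bullet> z' = e" "x' = derived_point z' u'"
    using x by (auto simp: in_Der_iff)
  have *: "(\<Sum>w\<in>Der c z. h (derived_point z u \<bullet> w))
      = (\<Sum>v\<in>X. if z \<bullet> v = c then h (derived_angle e c (u \<bullet> v)) else 0)"
    if "z \<in> X" "u \<in> X" "u \<bullet> z = e" for z u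
  proof -
    have "(\<Sum>w\<in>Der c z. h (derived_point z u \<bullet> w))
        = (\<Sum>v | v \<in> X \<and> v \<bullet> z = c. h (derived_angle e c (u \<bullet> v)))"
      unfolding sum_Der[OF that(1) c]
      using that e c by (intro sum.cong refl) (auto simp: inner_derived_point_X)
    also have "\<dots> = (\<Sum>v\<in>X. if z \<bullet> v = c then h (derived_angle e c (u \<bullet> v)) else 0)"
      using finite_X by (simp add: sum.inter_filter inner_commute[of z])
    finally show ?thesis .
  qed
  have "z \<bullet> u = z' \<bullet> u'"
    using u u' by (simp add: inner_commute)
  then show ?thesis
    unfolding u(3) u'(3) *[OF z(1) u(1,2)] *[OF z(2) u'(1,2)]
    by (rule sum_transfer[OF z(1) u(1) z(2) u'(1)])
qed

lemma card_Der_transfer: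
  assumes "z \<in> X" "z' \<in> X" "\<bar>a\<bar> < 1"
  shows "card (Der a z) = card (Der a z')"
proof -
  have "card (Der a z) = card {y \<in> X. z \<bullet> y = a}" if "z \<in> X" for z
    unfolding derived_design_eq_image
    using card_image[OF derived_point_inj_on[OF norm_X[OF that] X_unit assms(3)]]
    by (simp add: inner_commute[of z])
  moreover have "z \<bullet> z = z' \<bullet> z'"
    using norm_X assms by (simp add: dot_square_norm)
  ultimately show ?thesis
    using assms card_transfer[of z z z' z' "\<lambda>b c. b = a"] by simp
qed

text \<open>For a scheme with relations \<open>R k\<close> defined by inner products \<open>\<alpha> k\<close>, the existence of \<open>w\<close> says
  that the intersection number for \<open>a = \<alpha> i\<close>, \<open>b = \<alpha> j\<close> and \<open>x \<bullet> y = \<alpha> k\<close> is nonzero.\<close>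

definition derived_angles :: "real \<Rightarrow> real \<Rightarrow> real set" where
  "derived_angles a b =
     {derived_angle a b (x \<bullet> y) | x y. x \<in> X \<and> y \<in> X \<and> (\<exists>w\<in>X. x \<bullet> w = a \<and> w \<bullet> y = b)} - {1, -1}"

lemma finite_derived_angles: "finite (derived_angles a b)"
proof (rule finite_subset)
  show "derived_angles a b \<subseteq> derived_angle a b ` inner_products"
    by (auto simp: derived_angles_def inner_products_def)
qed (use finite_inner_products in simp)

lemma Der_unit: "u \<in> Der a z \<Longrightarrow> z \<in> X \<Longrightarrow> \<bar>a\<bar> < 1 \<Longrightarrow> norm u = 1"
  using Der_subset[of z a] by auto

lemma Der_orthogonal: "u \<in> Der a z \<Longrightarrow> z \<in> X \<Longrightarrow> \<bar>a\<bar> < 1 \<Longrightarrow> z \<bullet> u = 0"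
  using Der_subset[of z a] by (auto simp: perp_def inner_commute)

lemma angle_set_Der:
  assumes z: "z \<in> X" and a: "\<bar>a\<bar> < 1" and b: "\<bar>b\<bar> < 1"
  shows "angle_set (Der a z) (Der b z) = derived_angles a b"
proof
  show "angle_set (Der a z) (Der b z) \<subseteq> derived_angles a b"
  proof
    fix g assume "g \<in> angle_set (Der a z) (Der b z)"
    then obtain u v where uv: "u \<in> Der a z" "v \<in> Der b z" "u \<noteq> v" "u \<noteq> - v" "g = u \<bullet> v"
      by (auto simp: angle_set_def)
    then obtain x y where xy: "x \<in> X" "x \<bullet> z = a" "u = derived_point z x"
        "y \<in> X" "y \<bullet> z = b" "v = derived_point z y"
      by (auto simp: in_Der_iff)
    have "g = derived_angle a b (x \<bullet> y)"
      using uv(5) xy inner_derived_point_X[OF xy(1,4) z xy(2,5) a b] by simp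
    moreover have "g \<noteq> 1" "g \<noteq> -1"
      using uv inner_unit_eq_sign_iff[OF Der_unit[OF uv(1) z a] Der_unit[OF uv(2) z b], of 1]
        inner_unit_eq_sign_iff[OF Der_unit[OF uv(1) z a] Der_unit[OF uv(2) z b], of "-1"]
      by auto
    moreover have "\<exists>w\<in>X. x \<bullet> w = a \<and> w \<bullet> y = b"
      using xy z by (auto simp: inner_commute intro!: bexI[of _ z])
    ultimately show "g \<in> derived_angles a b"
      using xy(1,4) unfolding derived_angles_def by blast
  qed
next
  show "derived_angles a b \<subseteq> angle_set (Der a z) (Der b z)"
  proof
    fix g assume "g \<in> derived_angles a b"
    then obtain x y w where xyw: "x \<in> X" "y \<in> X" "w \<in> X" "x \<bullet> w = a" "w \<bullet> y = b"
        "g = derived_angle a b (x \<bullet> y)" and g: "g \<noteq> 1" "g \<noteq> -1"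
      by (auto simp: derived_angles_def)
    have "w \<bullet> w = z \<bullet> z"
      using norm_X xyw(3) z by (simp add: dot_square_norm)
    then obtain x' where x': "x' \<in> X" "z \<bullet> x' = w \<bullet> x"
      using point_transfer[OF xyw(3) xyw(3) z z _ xyw(1)] by metis
    then obtain y' where y': "y' \<in> X" "z \<bullet> y' = w \<bullet> y" "x' \<bullet> y' = x \<bullet> y"
      using point_transfer[OF xyw(3) xyw(1) z x'(1) _ xyw(2)] by metis
    have ip: "x' \<bullet> z = a" "y' \<bullet> z = b"
      using x' y' xyw by (simp_all add: inner_commute)
    define u v where "u = derived_point z x'" and "v = derived_point z y'"
    have uv: "u \<in> Der a z" "v \<in> Der b z"
      using ip x' y' by (auto simp: u_def v_def in_Der_iff)
    moreover have guv: "g = u \<bullet> v"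
      using inner_derived_point_X[OF x'(1) y'(1) z ip a b] xyw(6) y'(3) by (simp add: u_def v_def)
    moreover have "u \<noteq> v" "u \<noteq> - v"
      using g guv inner_unit_eq_sign_iff[OF Der_unit[OF uv(1) z a] Der_unit[OF uv(2) z b], of 1]
        inner_unit_eq_sign_iff[OF Der_unit[OF uv(1) z a] Der_unit[OF uv(2) z b], of "-1"]
      by auto
    ultimately show "g \<in> angle_set (Der a z) (Der b z)"
      unfolding angle_set_def by blast
  qed
qed

text \<open>The sign \<open>\<epsilon> = 1\<close> treats equality and \<open>\<epsilon> = -1\<close> antipodality of points of two derived designs. If
  \<open>x\<close> and \<open>y\<close> project to \<open>u\<close> and \<open>\<epsilon> *\<^sub>R u\<close>, the pair \<open>(x, y)\<close> can be transported to \<open>z'\<close> with any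
  given first member, and the projections keep the inner product \<open>\<epsilon>\<close>.\<close>

lemma signed_Der_transfer:
  assumes z: "z \<in> X" "z' \<in> X" and a: "\<bar>a\<bar> < 1" and b: "\<bar>b\<bar> < 1" and \<epsilon>: "\<epsilon> \<in> {1, -1}"
    and u: "u \<in> Der a z" "\<epsilon> *\<^sub>R u \<in> Der b z" and u': "u' \<in> Der a z'"
  shows "\<epsilon> *\<^sub>R u' \<in> Der b z'"
proof -
  obtain x where x: "x \<in> X" "x \<bullet> z = a" "u = derived_point z x"
    using u(1) by (auto simp: in_Der_iff)
  obtain y where y: "y \<in> X" "y \<bullet> z = b" "\<epsilon> *\<^sub>R u = derived_point z y"
    using u(2) by (auto simp: in_Der_iff)
  obtain x' where x': "x' \<in> X" "x' \<bullet> z' = a" "u' = derived_point z' x'"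
    using u' by (auto simp: in_Der_iff)
  have "z \<bullet> x = z' \<bullet> x'"
    using x x' by (simp add: inner_commute)
  then obtain y' where y': "y' \<in> X" "z' \<bullet> y' = z \<bullet> y" "x' \<bullet> y' = x \<bullet> y"
    using point_transfer[OF z(1) x(1) z(2) x'(1) _ y(1)] by metis
  have y'b: "y' \<bullet> z' = b"
    using y' y by (simp add: inner_commute)
  have v: "derived_point z' y' \<in> Der b z'"
    using y' y'b by (auto simp: in_Der_iff)
  have "derived_point z' y' \<bullet> u' = derived_angle b a (y' \<bullet> x')"
    unfolding x'(3) by (rule inner_derived_point_X[OF y'(1) x'(1) z(2) y'b x'(2) b a])
  also have "\<dots> = derived_angle b a (y \<bullet> x)"
    using y' by (simp add: inner_commute)
  also have "\<dots> = (\<epsilon> *\<^sub>R u) \<bullet> u"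
    unfolding y(3) unfolding x(3) by (rule inner_derived_point_X[OF y(1) x(1) z(1) y(2) x(2) b a, symmetric])
  also have "\<dots> = \<epsilon>"
    using Der_unit[OF u(1) z(1) a] by (simp add: norm_eq_1)
  finally have "derived_point z' y' = \<epsilon> *\<^sub>R u'"
    using inner_unit_eq_sign_iff[OF Der_unit[OF v z(2) b] Der_unit[OF u' z(2) a] \<epsilon>] by simp
  then show ?thesis
    using v by simp
qed

lemma spherical_design_Der_transfer:
  assumes z: "z \<in> X" "z' \<in> X" and a: "a \<in> inner_products" "\<bar>a\<bar> < 1"
  shows "spherical_design (perp z) t (Der a z) \<longleftrightarrow> spherical_design (perp z') t (Der a z')"
proof (rule spherical_design_transfer)
  fix m
  obtain x' where x': "x' \<in> Der a z'"
    using Der_nonempty[OF z(2) a(1)] by blast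
  have "(\<Sum>x\<in>Der a z. \<Sum>y\<in>Der a z. (x \<bullet> y) ^ m)
      = real (card (Der a z)) * (\<Sum>y\<in>Der a z'. (x' \<bullet> y) ^ m)"
    using sum_Der_transfer[OF z _ x' a(2) a(2), of _ "\<lambda>b. b ^ m"] by simp
  also have "\<dots> = real (card (Der a z')) * (\<Sum>y\<in>Der a z'. (x' \<bullet> y) ^ m)"
    using card_Der_transfer[OF z a(2)] by simp
  also have "\<dots> = (\<Sum>x\<in>Der a z'. \<Sum>y\<in>Der a z'. (x \<bullet> y) ^ m)"
    using sum_Der_transfer[OF z(2) z(2) _ x' a(2) a(2), of _ "\<lambda>b. b ^ m"] by simp
  finally show "(\<Sum>x\<in>Der a z. \<Sum>y\<in>Der a z. (x \<bullet> y) ^ m) = (\<Sum>x\<in>Der a z'. \<Sum>y\<in>Der a z'. (x \<bullet> y) ^ m)" .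
qed (intro norm_X z finite_Der Der_nonempty Der_subset card_Der_transfer a)+

section \<open>Joint counts and triple intersection numbers\<close>

definition joint_count_invariant :: "real \<Rightarrow> real \<Rightarrow> real \<Rightarrow> real \<Rightarrow> real \<Rightarrow> real \<Rightarrow> bool" where
  "joint_count_invariant e c f \<gamma> a b \<longleftrightarrow>
     (\<forall>z\<in>X. \<forall>z'\<in>X. \<forall>x\<in>Der e z. \<forall>y\<in>Der f z. \<forall>x'\<in>Der e z'. \<forall>y'\<in>Der f z'.
        x \<bullet> y = \<gamma> \<longrightarrow> x' \<bullet> y' = \<gamma> \<longrightarrow>
        joint_count (Der c z) a b x y = joint_count (Der c z') a b x' y')"

lemma joint_count_sign_transfer:
  assumes z: "z \<in> X" "z' \<in> X" and e: "\<bar>e\<bar> < 1" and c: "\<bar>c\<bar> < 1"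
    and x: "x \<in> Der e z" "x' \<in> Der e z'" and ip: "x \<bullet> y = x' \<bullet> y'" and \<epsilon>: "\<epsilon> \<in> {1, -1}"
  shows "joint_count (Der c z) \<epsilon> b x y = joint_count (Der c z') \<epsilon> b x' y'"
proof -
  have "\<epsilon> *\<^sub>R x \<in> Der c z \<longleftrightarrow> \<epsilon> *\<^sub>R x' \<in> Der c z'"
    using signed_Der_transfer[OF z e c \<epsilon> x(1) _ x(2)]
      signed_Der_transfer[OF z(2,1) e c \<epsilon> x(2) _ x(1)] by blast
  then show ?thesis
    using joint_count_sign[of x "Der c z" \<epsilon> b y] joint_count_sign[of x' "Der c z'" \<epsilon> b y']
      Der_unit[OF x(1) z(1) e] Der_unit[OF x(2) z(2) e] Der_unit[OF _ z(1) c] Der_unit[OF _ z(2) c] \<epsilon> ip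
    by (simp add: inner_commute)
qed

text \<open>Here \<open>y = \<epsilon> *\<^sub>R x\<close>, so the count involves inner products with \<open>x\<close> alone.\<close>

lemma joint_count_invariant_sign:
  assumes e: "\<bar>e\<bar> < 1" and c: "\<bar>c\<bar> < 1" and f: "\<bar>f\<bar> < 1" and \<epsilon>: "\<epsilon> \<in> {1, -1}"
  shows "joint_count_invariant e c f \<epsilon> a b"
  unfolding joint_count_invariant_def
proof (intro ballI impI)
  have *: "real (joint_count (Der c z) a b x y)
      = (\<Sum>w\<in>Der c z. if x \<bullet> w = a \<and> \<epsilon> * (x \<bullet> w) = b then 1 else 0)"
    if "z \<in> X" "x \<in> Der e z" "y \<in> Der f z" "x \<bullet> y = \<epsilon>" for z x y
  proof -
    have "y \<bullet> x = \<epsilon>"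
      using that(4) by (simp add: inner_commute)
    then have "y = \<epsilon> *\<^sub>R x"
      using inner_unit_eq_sign_iff[OF Der_unit[OF that(3,1) f] Der_unit[OF that(2,1) e] \<epsilon>] by simp
    then show ?thesis
      using finite_Der by (simp add: joint_count_def sum.If_cases Int_def)
  qed
  fix z z' x y x' y'
  assume h: "z \<in> X" "z' \<in> X" "x \<in> Der e z" "y \<in> Der f z" "x' \<in> Der e z'" "y' \<in> Der f z'"
    "x \<bullet> y = \<epsilon>" "x' \<bullet> y' = \<epsilon>"
  have "real (joint_count (Der c z) a b x y) = real (joint_count (Der c z') a b x' y')"
    unfolding *[OF h(1,3,4,7)] *[OF h(2,5,6,8)]
    by (rule sum_Der_transfer[OF h(1,2,3,5) e c])
  then show "joint_count (Der c z) a b x y = joint_count (Der c z') a b x' y'"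
    by simp
qed

lemma inner_Der_in_derived_angles:
  assumes "z \<in> X" "\<bar>a\<bar> < 1" "\<bar>b\<bar> < 1" "u \<in> Der a z" "v \<in> Der b z"
  shows "u \<bullet> v \<in> derived_angles a b \<union> {1, -1}"
proof (cases "u = v \<or> u = - v")
  case True
  then show ?thesis
    using Der_unit[OF assms(5,1,3)] by (auto simp: norm_eq_1)
next
  case False
  then have "u \<bullet> v \<in> angle_set (Der a z) (Der b z)"
    using assms unfolding angle_set_def by blast
  then show ?thesis
    using angle_set_Der[OF assms(1-3)] by simp
qed

lemma derived_angles_sym: "derived_angles a b = derived_angles b a"
proof -
  have "derived_angles a b \<subseteq> derived_angles b a" for a b
  proof
    fix g assume "g \<in> derived_angles a b"
    then obtain x y w where h: "x \<in> X" "y \<in> X" "w \<in> X" "x \<bullet> w = a" "w \<bullet> y = b"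
        "g = derived_angle a b (x \<bullet> y)" "g \<notin> {1, -1}"
      unfolding derived_angles_def by blast
    then have "g = derived_angle b a (y \<bullet> x)" "y \<bullet> w = b" "w \<bullet> x = a"
      by (simp_all add: derived_angle_def inner_commute mult.commute)
    then show "g \<in> derived_angles b a"
      using h unfolding derived_angles_def by blast
  qed
  then show ?thesis by blast
qed

text \<open>The arrays of joint counts at \<open>z\<close> and at \<open>z'\<close> have the same moments of degree at most \<open>t\<close>, because
  these are moments of the uniform measure for pairs with the same Gram matrix. Restricted to
  inner products different from \<open>1\<close> and \<open>-1\<close>, the difference of the arrays therefore annihilates all
  polynomials of degree at most \<open>t\<close>.\<close>

lemma joint_count_invariant_of_design:
  assumes e: "\<bar>e\<bar> < 1" and c: "\<bar>c\<bar> < 1" and f: "\<bar>f\<bar> < 1"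
    and design: "\<And>z. z \<in> X \<Longrightarrow> spherical_design (perp z) t (Der c z)"
    and cond:
      "int (card (derived_angles e c)) + int (card (derived_angles c f)) - 2 \<le> int t \<or>
       (int (card (derived_angles e c)) + int (card (derived_angles c f)) - 3 = int t \<and>
         (\<exists>a\<in>derived_angles e c. \<exists>b\<in>derived_angles c f. joint_count_invariant e c f \<gamma> a b)) \<or>
       (int (card (derived_angles e c)) + int (card (derived_angles c f)) - 4 = int t \<and>
         (\<exists>a\<in>derived_angles e c. \<exists>a'\<in>derived_angles e c.
          \<exists>b\<in>derived_angles c f. \<exists>b'\<in>derived_angles c f. a \<noteq> a' \<and> b \<noteq> b' \<and>
            joint_count_invariant e c f \<gamma> a b \<and> joint_count_invariant e c f \<gamma> a b' \<and>
            joint_count_invariant e c f \<gamma> a' b))"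
  shows "joint_count_invariant e c f \<gamma> a b"
  unfolding joint_count_invariant_def
proof (intro ballI impI)
  fix z z' x y x' y'
  assume z: "z \<in> X" "z' \<in> X"
    and x: "x \<in> Der e z" and y: "y \<in> Der f z" and x': "x' \<in> Der e z'" and y': "y' \<in> Der f z'"
    and \<gamma>: "x \<bullet> y = \<gamma>" "x' \<bullet> y' = \<gamma>"
  define P Q where "P = derived_angles e c" and "Q = derived_angles c f"
  define N where "N a b = real (joint_count (Der c z) a b x y) - real (joint_count (Der c z') a b x' y')" for a b
  have fin: "finite P" "finite Q"
    by (simp_all add: P_def Q_def finite_derived_angles)
  \<comment> \<open>The inner products \<open>1\<close> and \<open>-1\<close> occur only for the points \<open>x\<close>, \<open>-x\<close>, \<open>y\<close> and \<open>-y\<close>.\<close>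
  have border: "N u v = 0" if "u \<in> {1, -1} \<or> v \<in> {1, -1}" for u v
    using that
  proof
    assume "u \<in> {1, -1}"
    then show ?thesis
      using joint_count_sign_transfer[OF z e c x x', of y y' u v] \<gamma> by (simp add: N_def)
  next
    assume "v \<in> {1, -1}"
    then have "joint_count (Der c z) v u y x = joint_count (Der c z') v u y' x'"
      using joint_count_sign_transfer[OF z f c y y', of x x' v u] \<gamma> by (simp add: inner_commute)
    then show ?thesis
      by (simp add: N_def joint_count_swap[of _ u v])
  qed
  have range: "x \<bullet> w \<in> P \<union> {1, -1}" "y \<bullet> w \<in> Q \<union> {1, -1}"
    if "z \<in> X" "x \<in> Der e z" "y \<in> Der f z" "w \<in> Der c z" for x y z w
    using inner_Der_in_derived_angles[OF that(1) e c that(2,4)]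
      inner_Der_in_derived_angles[OF that(1) f c that(3,4)] derived_angles_sym[of f c]
    by (simp_all add: P_def Q_def)
  have outside: "N u v = 0" if "u \<notin> P \<union> {1, -1} \<or> v \<notin> Q \<union> {1, -1}" for u v
  proof -
    have "{w \<in> Der c z. x \<bullet> w = u \<and> y \<bullet> w = v} = {}" "{w \<in> Der c z'. x' \<bullet> w = u \<and> y' \<bullet> w = v} = {}"
      using that range[OF z(1) x y] range[OF z(2) x' y'] by blast+
    then show ?thesis
      unfolding N_def joint_count_def by (simp only: diff_self)
  qed
  have ann: "annihilates_moments t P Q N"
    unfolding annihilates_moments_def
  proof (intro allI impI)
    fix l m assume lm: "l + m \<le> t"
    let ?P = "P \<union> {1, -1}" and ?Q = "Q \<union> {1, -1}"
    have count: "(\<Sum>w\<in>Der c z. (x \<bullet> w) ^ l * (y \<bullet> w) ^ m)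
        = (\<Sum>u\<in>?P. \<Sum>v\<in>?Q. real (joint_count (Der c z) u v x y) * (u ^ l * v ^ m))"
      if "z \<in> X" "x \<in> Der e z" "y \<in> Der f z" for x y z
      using range[OF that] fin finite_Der by (intro sum_over_inner_products) auto
    have gram: "norm x = norm x'" "norm y = norm y'" "z \<bullet> x = z' \<bullet> x'" "z \<bullet> y = z' \<bullet> y'" "x \<bullet> y = x' \<bullet> y'"
      using Der_unit[OF x z(1) e] Der_unit[OF x' z(2) e] Der_unit[OF y z(1) f] Der_unit[OF y' z(2) f]
        Der_orthogonal[OF x z(1) e] Der_orthogonal[OF x' z(2) e]
        Der_orthogonal[OF y z(1) f] Der_orthogonal[OF y' z(2) f] \<gamma> by simp_all
    have "(\<Sum>w\<in>Der c z. (x \<bullet> w) ^ l * (y \<bullet> w) ^ m) = (\<Sum>w\<in>Der c z'. (x' \<bullet> w) ^ l * (y' \<bullet> w) ^ m)"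
      unfolding spherical_design_mixed_moment[OF norm_X[OF z(1)] design[OF z(1)] lm]
        spherical_design_mixed_moment[OF norm_X[OF z(2)] design[OF z(2)] lm]
        card_Der_transfer[OF z c] mixed_moment_Gram[OF norm_X[OF z(1)] norm_X[OF z(2)] gram] ..
    then have "(\<Sum>u\<in>?P. \<Sum>v\<in>?Q. N u v * (u ^ l * v ^ m)) = 0"
      unfolding count[OF z(1) x y] count[OF z(2) x' y'] N_def
      by (simp add: left_diff_distrib sum_subtractf)
    then have "(\<Sum>(u, v)\<in>?P \<times> ?Q. N u v * (u ^ l * v ^ m)) = 0"
      by (simp only: sum.cartesian_product)
    moreover have "(\<Sum>(u, v)\<in>?P \<times> ?Q. N u v * (u ^ l * v ^ m)) = (\<Sum>(u, v)\<in>P \<times> Q. N u v * (u ^ l * v ^ m))"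
      using fin border by (intro sum.mono_neutral_right) auto
    ultimately show "(\<Sum>u\<in>P. \<Sum>v\<in>Q. N u v * (u ^ l * v ^ m)) = 0"
      by (simp only: sum.cartesian_product)
  qed
  have known: "N u v = 0" if "joint_count_invariant e c f \<gamma> u v" for u v
  proof -
    have "joint_count (Der c z) u v x y = joint_count (Der c z') u v x' y'"
      using that z x y x' y' \<gamma> unfolding joint_count_invariant_def by blast
    then show ?thesis by (simp add: N_def)
  qed
  have "N u v = 0" if uv: "u \<in> P" "v \<in> Q" for u v
    using cond unfolding P_def[symmetric] Q_def[symmetric]
  proof (elim disjE conjE bexE)
    assume "int (card P) + int (card Q) - 2 \<le> int t"
    then show ?thesis
      by (rule annihilated_zero_tensor[OF ann fin _ uv])
  next
    fix a b
    assume "int (card P) + int (card Q) - 3 = int t" "a \<in> P" "b \<in> Q" "joint_count_invariant e c f \<gamma> a b"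
    then show ?thesis
      using annihilated_zero_one_entry[OF ann fin _ _ _ known uv] by blast
  next
    fix a a' b b'
    assume "int (card P) + int (card Q) - 4 = int t" "a \<in> P" "a' \<in> P" "b \<in> Q" "b' \<in> Q" "a \<noteq> a'" "b \<noteq> b'"
      "joint_count_invariant e c f \<gamma> a b" "joint_count_invariant e c f \<gamma> a b'"
      "joint_count_invariant e c f \<gamma> a' b"
    then show ?thesis
      using annihilated_zero_three_entries[OF ann fin _ _ _ _ _ _ _ known known known uv] by blast
  qed
  then have "N a b = 0"
    using border outside by blast
  then show "joint_count (Der c z) a b x y = joint_count (Der c z') a b x' y'"
    by (simp add: N_def)
qed

text \<open>If \<open>x\<close> is \<open>z\<close> or \<open>-z\<close>, its inner products are those of \<open>z\<close> up to a common sign.\<close>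

lemma triple_count_degenerate:
  assumes X: "x \<in> X" "y \<in> X" "z \<in> X" "x' \<in> X" "y' \<in> X" "z' \<in> X"
    and ip: "y \<bullet> z = y' \<bullet> z'" "z \<bullet> x = z' \<bullet> x'" and \<epsilon>: "z \<bullet> x \<in> {1, -1}"
  shows "card {w \<in> X. w \<bullet> x = a \<and> w \<bullet> y = b \<and> w \<bullet> z = c}
    = card {w \<in> X. w \<bullet> x' = a \<and> w \<bullet> y' = b \<and> w \<bullet> z' = c}"
proof -
  have *: "{w \<in> X. w \<bullet> x = a \<and> w \<bullet> y = b \<and> w \<bullet> z = c}
      = {w \<in> X. (z \<bullet> x) * (z \<bullet> w) = a \<and> y \<bullet> w = b \<and> z \<bullet> w = c}"
    if "x \<in> X" "z \<in> X" "z \<bullet> x \<in> {1, -1}" for x y z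
  proof -
    have "x = (z \<bullet> x) *\<^sub>R z"
      using inner_unit_eq_sign_iff[OF norm_X[OF that(1)] norm_X[OF that(2)] that(3)]
      by (simp add: inner_commute)
    then have "w \<bullet> x = (z \<bullet> x) * (z \<bullet> w)" for w
      by (metis inner_commute inner_scaleR_left)
    then show ?thesis
      by (auto simp: inner_commute)
  qed
  have "z \<bullet> y = z' \<bullet> y'"
    using ip by (simp add: inner_commute)
  then have "card {w \<in> X. (z \<bullet> x) * (z \<bullet> w) = a \<and> y \<bullet> w = b \<and> z \<bullet> w = c}
      = card {w \<in> X. (z \<bullet> x) * (z' \<bullet> w) = a \<and> y' \<bullet> w = b \<and> z' \<bullet> w = c}"
    by (rule card_transfer[OF X(3,2,6,5), of "\<lambda>u v. (z \<bullet> x) * u = a \<and> v = b \<and> u = c"])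
  then show ?thesis
    using *[OF X(1,3) \<epsilon>, of y] *[OF X(4,6), of y'] \<epsilon> ip(2) by simp
qed

text \<open>The only candidate for \<open>w\<close> is \<open>c *\<^sub>R z\<close>, and whether it belongs to \<open>X\<close> is independent of \<open>z\<close>.\<close>

lemma triple_count_sign:
  assumes X: "z \<in> X" "z' \<in> X" and ip: "y \<bullet> z = y' \<bullet> z'" "z \<bullet> x = z' \<bullet> x'" and c: "c \<in> {1, -1}"
  shows "card {w \<in> X. w \<bullet> x = a \<and> w \<bullet> y = b \<and> w \<bullet> z = c}
    = card {w \<in> X. w \<bullet> x' = a \<and> w \<bullet> y' = b \<and> w \<bullet> z' = c}"
proof -
  have *: "{w \<in> X. w \<bullet> x = a \<and> w \<bullet> y = b \<and> w \<bullet> z = c}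
      = (if c *\<^sub>R z \<in> X \<and> c * (z \<bullet> x) = a \<and> c * (y \<bullet> z) = b then {c *\<^sub>R z} else {})"
    if "z \<in> X" for x y z
  proof -
    have "w \<bullet> z = c \<longleftrightarrow> w = c *\<^sub>R z" if "w \<in> X" for w
      by (rule inner_unit_eq_sign_iff[OF norm_X[OF that] norm_X[OF \<open>z \<in> X\<close>] c])
    then have "{w \<in> X. w \<bullet> x = a \<and> w \<bullet> y = b \<and> w \<bullet> z = c}
        = {w \<in> X. w \<bullet> x = a \<and> w \<bullet> y = b \<and> w = c *\<^sub>R z}"
      by blast
    also have "\<dots> = (if c *\<^sub>R z \<in> X \<and> c * (z \<bullet> x) = a \<and> c * (y \<bullet> z) = b then {c *\<^sub>R z} else {})"
      by (auto simp: inner_commute)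
    finally show ?thesis .
  qed
  have mem: "c *\<^sub>R z' \<in> X" if zX: "z \<in> X" "z' \<in> X" "c *\<^sub>R z \<in> X" for z z'
  proof -
    have zz: "z \<bullet> z = 1" "z' \<bullet> z' = 1"
      using norm_X zX by (simp_all add: dot_square_norm)
    then obtain w where w: "w \<in> X" "z' \<bullet> w = z \<bullet> (c *\<^sub>R z)"
      using point_transfer[OF zX(1) zX(1) zX(2) zX(2) _ zX(3)] by metis
    then have "w \<bullet> z' = c"
      using zz by (simp add: inner_commute)
    then show ?thesis
      using inner_unit_eq_sign_iff[OF norm_X[OF w(1)] norm_X[OF zX(2)] c] w(1) by simp
  qed
  show ?thesis
    unfolding *[OF X(1)] *[OF X(2)] using mem[OF X] mem[OF X(2,1)] ip by auto
qed

lemma card_triple_eq_joint_count: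
  assumes X: "x \<in> X" "y \<in> X" "z \<in> X" and e: "x \<bullet> z = e" "\<bar>e\<bar> < 1" and f: "y \<bullet> z = f" "\<bar>f\<bar> < 1"
    and c: "\<bar>c\<bar> < 1"
  shows "card {w \<in> X. w \<bullet> x = a \<and> w \<bullet> y = b \<and> w \<bullet> z = c}
    = joint_count (Der c z) (derived_angle e c a) (derived_angle f c b) (derived_point z x) (derived_point z y)"
proof -
  let ?W = "{w \<in> X. w \<bullet> x = a \<and> w \<bullet> y = b \<and> w \<bullet> z = c}"
  have "derived_point z x \<bullet> derived_point z w = derived_angle e c a \<longleftrightarrow> w \<bullet> x = a"
    "derived_point z y \<bullet> derived_point z w = derived_angle f c b \<longleftrightarrow> w \<bullet> y = b"
    if "w \<in> X" "w \<bullet> z = c" for w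
    using inner_derived_point_X[OF X(1) that(1) X(3) e(1) that(2) e(2) c]
      inner_derived_point_X[OF X(2) that(1) X(3) f(1) that(2) f(2) c]
    by (simp_all add: derived_angle_eq_iff[OF e(2) c] derived_angle_eq_iff[OF f(2) c] inner_commute)
  then have "{u \<in> Der c z. derived_point z x \<bullet> u = derived_angle e c a \<and> derived_point z y \<bullet> u = derived_angle f c b}
      = derived_point z ` ?W"
    unfolding derived_design_eq_image by auto
  moreover have "inj_on (derived_point z) ?W"
    by (rule inj_on_subset[OF derived_point_inj_on[OF norm_X[OF X(3)] X_unit c]]) auto
  ultimately show ?thesis
    unfolding joint_count_def by (simp add: card_image)
qed

text \<open>The degenerate triples are those for which \<open>x\<close>, \<open>y\<close> or \<open>w\<close> has no projection to the sphere of
  the hyperplane orthogonal to \<open>z\<close>.\<close>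

lemma triple_count:
  assumes inv: "\<And>e c f \<gamma> a b. \<lbrakk>e \<in> inner_products; c \<in> inner_products; f \<in> inner_products;
      \<bar>e\<bar> < 1; \<bar>c\<bar> < 1; \<bar>f\<bar> < 1\<rbrakk> \<Longrightarrow> joint_count_invariant e c f \<gamma> a b"
    and X: "x \<in> X" "y \<in> X" "z \<in> X" "x' \<in> X" "y' \<in> X" "z' \<in> X"
    and ip: "x \<bullet> y = x' \<bullet> y'" "y \<bullet> z = y' \<bullet> z'" "z \<bullet> x = z' \<bullet> x'"
  shows "card {w \<in> X. w \<bullet> x = a \<and> w \<bullet> y = b \<and> w \<bullet> z = c}
    = card {w \<in> X. w \<bullet> x' = a \<and> w \<bullet> y' = b \<and> w \<bullet> z' = c}"
proof -
  consider "z \<bullet> x \<in> {1, -1}" | "y \<bullet> z \<in> {1, -1}" | "c \<in> {1, -1}"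
    | "c \<notin> inner_products" | "\<bar>z \<bullet> x\<bar> < 1" "\<bar>y \<bullet> z\<bar> < 1" "\<bar>c\<bar> < 1" "c \<in> inner_products"
  proof -
    have "c \<in> inner_products \<Longrightarrow> \<bar>c\<bar> \<le> 1"
      using abs_inner_unit_le_1 norm_X by (auto simp: inner_products_def)
    moreover have "\<bar>z \<bullet> x\<bar> \<le> 1" "\<bar>y \<bullet> z\<bar> \<le> 1"
      using abs_inner_unit_le_1 norm_X X by auto
    ultimately show thesis
      using that by (auto simp: abs_if split: if_splits) (smt (verit))+
  qed
  then show ?thesis
  proof cases
    case 1
    then show ?thesis
      by (rule triple_count_degenerate[OF X ip(2,3)])
  next
    case 2
    have "card {w \<in> X. w \<bullet> y = b \<and> w \<bullet> x = a \<and> w \<bullet> z = c}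
        = card {w \<in> X. w \<bullet> y' = b \<and> w \<bullet> x' = a \<and> w \<bullet> z' = c}"
      using 2 ip by (intro triple_count_degenerate X) (auto simp: inner_commute)
    then show ?thesis
      by (simp add: conj_left_commute)
  next
    case 3
    then show ?thesis
      by (rule triple_count_sign[OF X(3,6) ip(2,3)])
  next
    case 4
    then have "{w \<in> X. w \<bullet> x = a \<and> w \<bullet> y = b \<and> w \<bullet> z = c} = {}" "{w \<in> X. w \<bullet> x' = a \<and> w \<bullet> y' = b \<and> w \<bullet> z' = c} = {}"
      using X by (auto simp: inner_products_def)
    then show ?thesis
      by (simp only:)
  next
    case 5
    define e f where "e = x \<bullet> z" and "f = y \<bullet> z"
    have e: "x \<bullet> z = e" "x' \<bullet> z' = e" "\<bar>e\<bar> < 1" and f: "y \<bullet> z = f" "y' \<bullet> z' = f" "\<bar>f\<bar> < 1"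
      using 5 ip by (simp_all add: e_def f_def inner_commute)
    have ef: "e \<in> inner_products" "f \<in> inner_products"
      using X by (auto simp: e_def f_def inner_products_def)
    let ?d = derived_point
    have "?d z x \<bullet> ?d z y = derived_angle e f (x \<bullet> y)" "?d z' x' \<bullet> ?d z' y' = derived_angle e f (x \<bullet> y)"
      using inner_derived_point_X[OF X(1,2,3) e(1) f(1) e(3) f(3)]
        inner_derived_point_X[OF X(4,5,6) e(2) f(2) e(3) f(3)] ip(1) by simp_all
    moreover have "?d z x \<in> Der e z" "?d z y \<in> Der f z" "?d z' x' \<in> Der e z'" "?d z' y' \<in> Der f z'"
      using X e f by (auto simp: in_Der_iff)
    moreover have "joint_count_invariant e c f (derived_angle e f (x \<bullet> y)) (derived_angle e c a) (derived_angle f c b)"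
      by (rule inv[OF ef(1) 5(4) ef(2) e(3) 5(3) f(3)])
    ultimately have "joint_count (Der c z) (derived_angle e c a) (derived_angle f c b) (?d z x) (?d z y)
        = joint_count (Der c z') (derived_angle e c a) (derived_angle f c b) (?d z' x') (?d z' y')"
      using X(3,6) unfolding joint_count_invariant_def by blast
    then show ?thesis
      using card_triple_eq_joint_count[OF X(1,2,3) e(1,3) f(1,3) 5(3)]
        card_triple_eq_joint_count[OF X(4,5,6) e(2,3) f(2,3) 5(3)] by simp
  qed
qed

end

section \<open>Triple regularity\<close>

lemma intersection_number_eq:
  assumes "symmetric_association_scheme X R s" "i \<le> s" "j \<le> s" "k \<le> s" "(x, y) \<in> R k"
  shows "intersection_number X R i j k = card {w \<in> X. (x, w) \<in> R i \<and> (w, y) \<in> R j}"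
proof -
  obtain p where p: "\<forall>(x, y)\<in>R k. card {w \<in> X. (x, w) \<in> R i \<and> (w, y) \<in> R j} = p"
    using assms(1-4) unfolding symmetric_association_scheme_def by blast
  have "intersection_number X R i j k = p"
    unfolding intersection_number_def
  proof (rule the_equality)
    show "\<forall>(x, y)\<in>R k. card {w \<in> X. (x, w) \<in> R i \<and> (w, y) \<in> R j} = p"
      by (rule p)
  qed (use p assms(5) in fast)
  then show ?thesis
    using p assms(5) by auto
qed

lemma common_value_eq:
  assumes "X \<noteq> {}" "\<And>z. z \<in> X \<Longrightarrow> f z = v"
  shows "common_value X f = v"
  unfolding common_value_def using assms by (intro the_equality) auto

theorem corollary2p9:
  fixes X :: "(real ^ 'n) set"
    and s :: nat
    and \<alpha> :: "nat \<Rightarrow> real"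
    and R :: "nat \<Rightarrow> ((real ^ 'n) \<times> (real ^ 'n)) set"
    and p :: "nat \<Rightarrow> nat \<Rightarrow> nat \<Rightarrow> nat"
    and I :: "nat set"
    and D :: "nat \<Rightarrow> real ^ 'n \<Rightarrow> (real ^ 'n) set"
    and A :: "nat \<Rightarrow> nat \<Rightarrow> real set"
  assumes "finite X"
    and "X \<subseteq> sphere 0 1"
    and "{x \<bullet> y | x y. x \<in> X \<and> y \<in> X \<and> x \<noteq> y} = \<alpha> ` {1..s}"
    and "inj_on \<alpha> {1..s}"
    and "\<alpha> 0 = 1"
    and R: "R = (\<lambda>k. {(x, y). x \<in> X \<and> y \<in> X \<and> x \<bullet> y = \<alpha> k})"
    and "symmetric_association_scheme X R s"
    and p: "p = intersection_number X R"
    and I: "I = {i \<in> {1..s}. \<alpha> i \<noteq> -1}"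
    and D: "D = (\<lambda>i z. derived_design X (\<alpha> i) z)"
    and A: "A = (\<lambda>i j. common_value X (\<lambda>z. angle_set (D i z) (D j z)))"
  shows
    "(\<forall>i\<in>I. \<forall>j\<in>I.
        (\<forall>z\<in>X. angle_set (D i z) (D j z) =
           {derived_angle (\<alpha> i) (\<alpha> j) (\<alpha> k) | k. k \<le> s \<and> p i j k \<noteq> 0 \<and>
              derived_angle (\<alpha> i) (\<alpha> j) (\<alpha> k) \<noteq> 1 \<and>
              derived_angle (\<alpha> i) (\<alpha> j) (\<alpha> k) \<noteq> -1}) \<and>
        (\<forall>z\<in>X. (D i z = D j z \<or> D i z \<inter> D j z = {}) \<and>
                (D i z = uminus ` D j z \<or> D i z \<inter> uminus ` D j z = {})) \<and>
        (\<forall>z\<in>X. \<forall>z'\<in>X.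
           kronecker (D i z) (D j z) = kronecker (D i z') (D j z') \<and>
           kronecker (D i z) (uminus ` D j z) = kronecker (D i z') (uminus ` D j z')) \<and>
        (\<forall>z\<in>X. \<forall>z'\<in>X. \<forall>t. has_strength (perp z) (D i z) t \<longleftrightarrow> has_strength (perp z') (D i z') t)) \<and>
     (\<forall>t :: nat \<Rightarrow> nat.
        (\<forall>i\<in>I. 1 \<le> t i \<and> (\<forall>z\<in>X. spherical_design (perp z) (t i) (D i z))) \<and>
        (\<forall>i\<in>I. \<forall>j\<in>I. \<forall>k\<in>I.
           int (card (A i j)) + int (card (A j k)) - 2 \<le> int (t j) \<or>
           (int (card (A i j)) + int (card (A j k)) - 3 = int (t j) \<and>
              (\<forall>\<gamma>\<in>A i k. \<exists>a\<in>A i j. \<exists>b\<in>A j k. joint_count_constant X D i j k \<gamma> a b)) \<or>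
           (int (card (A i j)) + int (card (A j k)) - 4 = int (t j) \<and>
              (\<forall>\<gamma>\<in>A i k. \<exists>a\<in>A i j. \<exists>a'\<in>A i j. \<exists>b\<in>A j k. \<exists>b'\<in>A j k. a \<noteq> a' \<and> b \<noteq> b' \<and>
                 joint_count_constant X D i j k \<gamma> a b \<and>
                 joint_count_constant X D i j k \<gamma> a b' \<and>
                 joint_count_constant X D i j k \<gamma> a' b)))
        \<longrightarrow> triply_regular_scheme X R s)"
proof -
  note scheme = \<open>symmetric_association_scheme X R s\<close>
  have norm: "norm x = 1" if "x \<in> X" for x
    using that \<open>X \<subseteq> sphere 0 1\<close> by auto
  have index: "\<exists>k\<le>s. x \<bullet> y = \<alpha> k" if "x \<in> X" "y \<in> X" for x y
  proof (cases "x = y")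
    case True
    then show ?thesis
      using norm[OF that(1)] \<open>\<alpha> 0 = 1\<close> by (intro exI[of _ 0]) (simp add: norm_eq_1)
  next
    case False
    then have "x \<bullet> y \<in> \<alpha> ` {1..s}"
      unfolding \<open>{x \<bullet> y | x y. x \<in> X \<and> y \<in> X \<and> x \<noteq> y} = \<alpha> ` {1..s}\<close>[symmetric] using that by blast
    then show ?thesis by auto
  qed
  have R_iff: "(x, y) \<in> R k \<longleftrightarrow> x \<in> X \<and> y \<in> X \<and> x \<bullet> y = \<alpha> k" for x y k
    by (simp add: R)
  have R_nonempty: "R k \<noteq> {}" if "k \<le> s" for k
    using scheme that unfolding symmetric_association_scheme_def partition_on_def by auto
  have "X \<noteq> {}"
    using R_nonempty[of 0] by (auto simp: R)
  have p_eq: "p i j k = joint_count X (\<alpha> i) (\<alpha> j) x y"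
    if "i \<le> s" "j \<le> s" "k \<le> s" "x \<in> X" "y \<in> X" "x \<bullet> y = \<alpha> k" for i j k x y
  proof -
    have "(x, y) \<in> R k"
      using that by (simp add: R_iff)
    then have "p i j k = card {w \<in> X. (x, w) \<in> R i \<and> (w, y) \<in> R j}"
      unfolding p by (rule intersection_number_eq[OF scheme that(1-3)])
    also have "{w \<in> X. (x, w) \<in> R i \<and> (w, y) \<in> R j} = {w \<in> X. x \<bullet> w = \<alpha> i \<and> y \<bullet> w = \<alpha> j}"
      using that by (auto simp: R_iff inner_commute)
    finally show ?thesis
      by (simp add: joint_count_def)
  qed

  \<comment> \<open>An inner product that is not among the \<open>\<alpha> k\<close> with \<open>k \<le> s\<close> does not occur,
    so the two counts are then both zero.\<close>
  interpret S: inner_product_scheme X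
  proof
    show "finite X" "X \<subseteq> sphere 0 1" by fact+
    fix x y x' y' a b
    assume h: "x \<in> X" "y \<in> X" "x' \<in> X" "y' \<in> X" "x \<bullet> y = x' \<bullet> y'"
    obtain k where k: "k \<le> s" "x \<bullet> y = \<alpha> k"
      using index[OF h(1,2)] by blast
    show "joint_count X a b x y = joint_count X a b x' y'"
    proof (cases "\<exists>i\<le>s. \<exists>j\<le>s. a = \<alpha> i \<and> b = \<alpha> j")
      case True
      then obtain i j where "i \<le> s" "j \<le> s" "a = \<alpha> i" "b = \<alpha> j" by blast
      then show ?thesis
        using p_eq[of i j k x y] p_eq[of i j k x' y'] k h by simp
    next
      case False
      have "joint_count X a b x y = 0" if "x \<in> X" "y \<in> X" for x y
      proof -
        have "\<not> (x \<bullet> w = a \<and> y \<bullet> w = b)" if "w \<in> X" for w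
          using index[OF \<open>x \<in> X\<close> that] index[OF \<open>y \<in> X\<close> that] False by metis
        then have "{w \<in> X. x \<bullet> w = a \<and> y \<bullet> w = b} = {}" by blast
        then show ?thesis
          unfolding joint_count_def by (simp only: card.empty)
      qed
      then show ?thesis
        using h by simp
    qed
  qed

  have inner_index: "\<exists>x y. x \<in> X \<and> y \<in> X \<and> x \<bullet> y = \<alpha> k" if "k \<le> s" for k
    using R_nonempty[OF that] by (auto simp: R)
  have I_le: "i \<le> s" if "i \<in> I" for i
    using that by (simp add: I)
  have I_inner: "\<alpha> i \<in> S.inner_products" if "i \<in> I" for i
  proof -
    obtain x y where "x \<in> X" "y \<in> X" "x \<bullet> y = \<alpha> i"
      using inner_index[OF I_le[OF \<open>i \<in> I\<close>]] by blast
    then show ?thesis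
      unfolding S.inner_products_def by (intro CollectI exI[of _ x] exI[of _ y]) simp
  qed
  have I_abs: "\<bar>\<alpha> i\<bar> < 1" if "i \<in> I" for i
  proof -
    have "\<alpha> i \<in> \<alpha> ` {1..s}"
      using that by (simp add: I)
    then obtain x y where xy: "x \<in> X" "y \<in> X" "x \<noteq> y" "x \<bullet> y = \<alpha> i"
      unfolding \<open>{x \<bullet> y | x y. x \<in> X \<and> y \<in> X \<and> x \<noteq> y} = \<alpha> ` {1..s}\<close>[symmetric] by auto
    have "\<alpha> i \<noteq> 1"
      using inner_unit_eq_sign_iff[OF norm norm, OF xy(1,2), of 1] xy by simp
    moreover have "\<alpha> i \<noteq> -1"
      using that by (simp add: I)
    moreover have "\<bar>\<alpha> i\<bar> \<le> 1"
      using abs_inner_unit_le_1[OF norm norm, OF xy(1,2)] xy(4) by simp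
    ultimately show ?thesis by linarith
  qed
  have I_index: "\<exists>i\<in>I. e = \<alpha> i" if "e \<in> S.inner_products" "\<bar>e\<bar> < 1" for e
  proof -
    obtain i where i: "i \<le> s" "e = \<alpha> i"
      using \<open>e \<in> S.inner_products\<close> index by (auto simp: S.inner_products_def)
    have "i \<noteq> 0"
    proof
      assume "i = 0"
      then show False
        using i that(2) \<open>\<alpha> 0 = 1\<close> by simp
    qed
    moreover have "\<alpha> i \<noteq> -1"
      using i that(2) by auto
    ultimately have "i \<in> I"
      using i by (simp add: I)
    then show ?thesis
      using i by blast
  qed
  have angle_set: "angle_set (D i z) (D j z) = S.derived_angles (\<alpha> i) (\<alpha> j)"
    if "i \<in> I" "j \<in> I" "z \<in> X" for i j z
    unfolding D by (rule S.angle_set_Der[OF that(3) I_abs[OF that(1)] I_abs[OF that(2)]])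
  have A_eq: "A i j = S.derived_angles (\<alpha> i) (\<alpha> j)" if "i \<in> I" "j \<in> I" for i j
    unfolding A by (rule common_value_eq[OF \<open>X \<noteq> {}\<close> angle_set[OF that]])

  have derived_angles: "S.derived_angles (\<alpha> i) (\<alpha> j) =
      {derived_angle (\<alpha> i) (\<alpha> j) (\<alpha> k) | k. k \<le> s \<and> p i j k \<noteq> 0 \<and>
        derived_angle (\<alpha> i) (\<alpha> j) (\<alpha> k) \<noteq> 1 \<and> derived_angle (\<alpha> i) (\<alpha> j) (\<alpha> k) \<noteq> -1}"
    (is "_ = ?rhs") if ij: "i \<in> I" "j \<in> I" for i j
  proof -
    have p_pos: "p i j k \<noteq> 0 \<longleftrightarrow> (\<exists>w\<in>X. x \<bullet> w = \<alpha> i \<and> w \<bullet> y = \<alpha> j)"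
      if "k \<le> s" "x \<in> X" "y \<in> X" "x \<bullet> y = \<alpha> k" for k x y
      unfolding p_eq[OF I_le[OF ij(1)] I_le[OF ij(2)] that] joint_count_def
      using \<open>finite X\<close> by (auto simp: card_eq_0_iff inner_commute[of y])
    show ?thesis
    proof
      show "S.derived_angles (\<alpha> i) (\<alpha> j) \<subseteq> ?rhs"
      proof
        fix g assume "g \<in> S.derived_angles (\<alpha> i) (\<alpha> j)"
        then obtain x y where xy: "x \<in> X" "y \<in> X" "\<exists>w\<in>X. x \<bullet> w = \<alpha> i \<and> w \<bullet> y = \<alpha> j"
            "g = derived_angle (\<alpha> i) (\<alpha> j) (x \<bullet> y)" "g \<notin> {1, -1}"
          unfolding S.derived_angles_def by blast
        moreover obtain k where "k \<le> s" "x \<bullet> y = \<alpha> k"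
          using index[OF xy(1,2)] by blast
        ultimately show "g \<in> ?rhs"
          using p_pos[of k x y] by auto
      qed
      show "?rhs \<subseteq> S.derived_angles (\<alpha> i) (\<alpha> j)"
      proof
        fix g assume "g \<in> ?rhs"
        then obtain k where k: "k \<le> s" "p i j k \<noteq> 0" "g = derived_angle (\<alpha> i) (\<alpha> j) (\<alpha> k)" "g \<notin> {1, -1}"
          by blast
        obtain x y where xy: "x \<in> X" "y \<in> X" "x \<bullet> y = \<alpha> k"
          using inner_index[OF k(1)] by blast
        have "\<exists>w\<in>X. x \<bullet> w = \<alpha> i \<and> w \<bullet> y = \<alpha> j"
          using p_pos[OF k(1) xy] k(2) by blast
        moreover have "g = derived_angle (\<alpha> i) (\<alpha> j) (x \<bullet> y)"
          using k(3) xy(3) by simp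
        ultimately show "g \<in> S.derived_angles (\<alpha> i) (\<alpha> j)"
          using xy(1,2) k(4) unfolding S.derived_angles_def by blast
      qed
    qed
  qed

  have equal: "D i z' = D j z'" if "i \<in> I" "j \<in> I" "z \<in> X" "z' \<in> X" "D i z \<inter> D j z \<noteq> {}" for i j z z'
  proof -
    obtain u where "u \<in> D i z" "u \<in> D j z"
      using \<open>D i z \<inter> D j z \<noteq> {}\<close> by blast
    then show ?thesis
      using S.signed_Der_transfer[OF that(3,4) I_abs[OF that(1)] I_abs[OF that(2)], of 1 u]
        S.signed_Der_transfer[OF that(3,4) I_abs[OF that(2)] I_abs[OF that(1)], of 1 u]
      unfolding D by auto
  qed
  have opposite: "D i z' = uminus ` D j z'"
    if "i \<in> I" "j \<in> I" "z \<in> X" "z' \<in> X" "D i z \<inter> uminus ` D j z \<noteq> {}" for i j z z'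
  proof -
    obtain u where u: "u \<in> D i z" "- u \<in> D j z"
      using \<open>D i z \<inter> uminus ` D j z \<noteq> {}\<close> by (metis disjoint_iff imageE minus_minus)
    have 1: "- v \<in> D j z'" if "v \<in> D i z'" for v
      using S.signed_Der_transfer[OF \<open>z \<in> X\<close> \<open>z' \<in> X\<close> I_abs[OF \<open>i \<in> I\<close>] I_abs[OF \<open>j \<in> I\<close>], of "-1" u v] u that
      unfolding D by simp
    have 2: "- v \<in> D i z'" if "v \<in> D j z'" for v
      using S.signed_Der_transfer[OF \<open>z \<in> X\<close> \<open>z' \<in> X\<close> I_abs[OF \<open>j \<in> I\<close>] I_abs[OF \<open>i \<in> I\<close>], of "-1" "- u" v] u that
      unfolding D by simp
    show ?thesis
    proof
      show "D i z' \<subseteq> uminus ` D j z'"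
        using 1 by (metis image_eqI minus_minus subsetI)
      show "uminus ` D j z' \<subseteq> D i z'"
        using 2 by blast
    qed
  qed
  have nonempty: "D i z \<noteq> {}" if "i \<in> I" "z \<in> X" for i z
    unfolding D by (rule S.Der_nonempty[OF that(2) I_inner[OF that(1)]])

  have strength: "has_strength (perp z) (D i z) t \<longleftrightarrow> has_strength (perp z') (D i z') t"
    if "i \<in> I" "z \<in> X" "z' \<in> X" for i z z' t
    unfolding has_strength_def D
    using S.spherical_design_Der_transfer[OF that(2,3) I_inner[OF that(1)] I_abs[OF that(1)]] by simp

  have triply: "triply_regular_scheme X R s"
    if design: "\<forall>i\<in>I. 1 \<le> t i \<and> (\<forall>z\<in>X. spherical_design (perp z) (t i) (D i z))"
      and cond: "\<forall>i\<in>I. \<forall>j\<in>I. \<forall>k\<in>I.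
           int (card (A i j)) + int (card (A j k)) - 2 \<le> int (t j) \<or>
           (int (card (A i j)) + int (card (A j k)) - 3 = int (t j) \<and>
              (\<forall>\<gamma>\<in>A i k. \<exists>a\<in>A i j. \<exists>b\<in>A j k. joint_count_constant X D i j k \<gamma> a b)) \<or>
           (int (card (A i j)) + int (card (A j k)) - 4 = int (t j) \<and>
              (\<forall>\<gamma>\<in>A i k. \<exists>a\<in>A i j. \<exists>a'\<in>A i j. \<exists>b\<in>A j k. \<exists>b'\<in>A j k. a \<noteq> a' \<and> b \<noteq> b' \<and>
                 joint_count_constant X D i j k \<gamma> a b \<and>
                 joint_count_constant X D i j k \<gamma> a b' \<and>
                 joint_count_constant X D i j k \<gamma> a' b))"
    for t :: "nat \<Rightarrow> nat"
  proof -
    have invariant: "S.joint_count_invariant (\<alpha> i) (\<alpha> j) (\<alpha> k) \<gamma> a b"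
      if "joint_count_constant X D i j k \<gamma> a b" for i j k \<gamma> a b
    proof -
      obtain N where "\<forall>z\<in>X. \<forall>x\<in>D i z. \<forall>y\<in>D k z. x \<bullet> y = \<gamma> \<longrightarrow> joint_count (D j z) a b x y = N"
        using \<open>joint_count_constant X D i j k \<gamma> a b\<close> unfolding joint_count_constant_def by blast
      then show ?thesis
        unfolding S.joint_count_invariant_def D by metis
    qed
    have inv: "S.joint_count_invariant e c f \<gamma> a b"
      if "e \<in> S.inner_products" "c \<in> S.inner_products" "f \<in> S.inner_products"
        "\<bar>e\<bar> < 1" "\<bar>c\<bar> < 1" "\<bar>f\<bar> < 1" for e c f \<gamma> a b
    proof -
      obtain i j k where i: "i \<in> I" "e = \<alpha> i" and j: "j \<in> I" "c = \<alpha> j" and k: "k \<in> I" "f = \<alpha> k"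
        using I_index \<open>e \<in> S.inner_products\<close> \<open>c \<in> S.inner_products\<close> \<open>f \<in> S.inner_products\<close>
          \<open>\<bar>e\<bar> < 1\<close> \<open>\<bar>c\<bar> < 1\<close> \<open>\<bar>f\<bar> < 1\<close> by metis
      \<comment> \<open>The assumptions speak only of \<open>\<gamma>\<close> in \<open>A i k\<close>; the other values are
        \<open>1\<close>, \<open>-1\<close> and those that no pair attains.\<close>
      consider "\<gamma> \<in> {1, -1}" | "\<gamma> \<in> A i k" | "\<gamma> \<notin> A i k \<union> {1, -1}" by blast
      then show ?thesis
      proof cases
        case 1
        then show ?thesis
          by (rule S.joint_count_invariant_sign[OF that(4-6)])
      next
        case 2
        have "S.joint_count_invariant (\<alpha> i) (\<alpha> j) (\<alpha> k) \<gamma> a b"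
        proof (rule S.joint_count_invariant_of_design[OF I_abs[OF i(1)] I_abs[OF j(1)] I_abs[OF k(1)]])
          show "spherical_design (perp z) (t j) (S.Der (\<alpha> j) z)" if "z \<in> X" for z
            using design j(1) that by (simp add: D)
          show "int (card (S.derived_angles (\<alpha> i) (\<alpha> j))) + int (card (S.derived_angles (\<alpha> j) (\<alpha> k))) - 2 \<le> int (t j) \<or>
              (int (card (S.derived_angles (\<alpha> i) (\<alpha> j))) + int (card (S.derived_angles (\<alpha> j) (\<alpha> k))) - 3 = int (t j) \<and>
                (\<exists>a\<in>S.derived_angles (\<alpha> i) (\<alpha> j). \<exists>b\<in>S.derived_angles (\<alpha> j) (\<alpha> k).
                  S.joint_count_invariant (\<alpha> i) (\<alpha> j) (\<alpha> k) \<gamma> a b)) \<or>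
              (int (card (S.derived_angles (\<alpha> i) (\<alpha> j))) + int (card (S.derived_angles (\<alpha> j) (\<alpha> k))) - 4 = int (t j) \<and>
                (\<exists>a\<in>S.derived_angles (\<alpha> i) (\<alpha> j). \<exists>a'\<in>S.derived_angles (\<alpha> i) (\<alpha> j).
                 \<exists>b\<in>S.derived_angles (\<alpha> j) (\<alpha> k). \<exists>b'\<in>S.derived_angles (\<alpha> j) (\<alpha> k). a \<noteq> a' \<and> b \<noteq> b' \<and>
                  S.joint_count_invariant (\<alpha> i) (\<alpha> j) (\<alpha> k) \<gamma> a b \<and>
                  S.joint_count_invariant (\<alpha> i) (\<alpha> j) (\<alpha> k) \<gamma> a b' \<and>
                  S.joint_count_invariant (\<alpha> i) (\<alpha> j) (\<alpha> k) \<gamma> a' b))"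
            using cond[rule_format, OF i(1) j(1) k(1)] 2 invariant
            unfolding A_eq[OF i(1) j(1), symmetric] A_eq[OF j(1) k(1), symmetric] by meson
        qed
        then show ?thesis
          by (simp add: i j k)
      next
        case 3
        have "x \<bullet> y \<noteq> \<gamma>" if "z \<in> X" "x \<in> S.Der (\<alpha> i) z" "y \<in> S.Der (\<alpha> k) z" for x y z
          using S.inner_Der_in_derived_angles[OF that(1) I_abs[OF i(1)] I_abs[OF k(1)] that(2,3)] 3
          unfolding A_eq[OF i(1) k(1)] by blast
        then show ?thesis
          unfolding S.joint_count_invariant_def i k by blast
      qed
    qed
    have "\<exists>N. \<forall>x\<in>X. \<forall>y\<in>X. \<forall>z\<in>X. (x, y) \<in> R i \<and> (y, z) \<in> R j \<and> (z, x) \<in> R k \<longrightarrow>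
        card {w \<in> X. (w, x) \<in> R m \<and> (w, y) \<in> R n \<and> (w, z) \<in> R l} = N" for i j k l m n
    proof -
      have *: "{w \<in> X. (w, x) \<in> R m \<and> (w, y) \<in> R n \<and> (w, z) \<in> R l}
          = {w \<in> X. w \<bullet> x = \<alpha> m \<and> w \<bullet> y = \<alpha> n \<and> w \<bullet> z = \<alpha> l}" if "x \<in> X" "y \<in> X" "z \<in> X" for x y z
        using that by (auto simp: R_iff)
      show ?thesis
      proof (cases "\<exists>x y z. (x, y) \<in> R i \<and> (y, z) \<in> R j \<and> (z, x) \<in> R k")
        case True
        then obtain x0 y0 z0 where 0: "(x0, y0) \<in> R i" "(y0, z0) \<in> R j" "(z0, x0) \<in> R k"
          by blast
        show ?thesis
        proof (intro exI ballI impI)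
          fix x y z
          assume X: "x \<in> X" "y \<in> X" "z \<in> X" and "(x, y) \<in> R i \<and> (y, z) \<in> R j \<and> (z, x) \<in> R k"
          then have ip: "x \<bullet> y = x0 \<bullet> y0" "y \<bullet> z = y0 \<bullet> z0" "z \<bullet> x = z0 \<bullet> x0"
              and X0: "x0 \<in> X" "y0 \<in> X" "z0 \<in> X"
            using 0 by (simp_all add: R_iff)
          show "card {w \<in> X. (w, x) \<in> R m \<and> (w, y) \<in> R n \<and> (w, z) \<in> R l}
              = card {w \<in> X. w \<bullet> x0 = \<alpha> m \<and> w \<bullet> y0 = \<alpha> n \<and> w \<bullet> z0 = \<alpha> l}"
            unfolding *[OF X] by (rule S.triple_count[OF inv X X0 ip])
        qed
      qed blast
    qed
    then show ?thesis
      unfolding triply_regular_scheme_def using scheme by blast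
  qed

  have kronecker: "kronecker (D i z) (D j z) = kronecker (D i z') (D j z')"
      "kronecker (D i z) (uminus ` D j z) = kronecker (D i z') (uminus ` D j z')"
    if ij: "i \<in> I" "j \<in> I" and z: "z \<in> X" "z' \<in> X" for i j z z'
  proof -
    have "D i z = D j z \<longleftrightarrow> D i z' = D j z'"
      using equal[OF ij z] equal[OF ij z(2,1)] nonempty[OF ij(1) z(1)] nonempty[OF ij(1) z(2)] by auto
    moreover have "D i z = uminus ` D j z \<longleftrightarrow> D i z' = uminus ` D j z'"
      using opposite[OF ij z] opposite[OF ij z(2,1)] nonempty[OF ij(1) z(1)] nonempty[OF ij(1) z(2)]
      by (metis Int_absorb)
    ultimately show "kronecker (D i z) (D j z) = kronecker (D i z') (D j z')"
      "kronecker (D i z) (uminus ` D j z) = kronecker (D i z') (uminus ` D j z')"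
      by (simp_all add: kronecker_def)
  qed

  show ?thesis
  proof (rule conjI; intro ballI allI impI conjI)
    fix i j z assume ij: "i \<in> I" "j \<in> I" and z: "z \<in> X"
    show "angle_set (D i z) (D j z) =
           {derived_angle (\<alpha> i) (\<alpha> j) (\<alpha> k) | k. k \<le> s \<and> p i j k \<noteq> 0 \<and>
              derived_angle (\<alpha> i) (\<alpha> j) (\<alpha> k) \<noteq> 1 \<and> derived_angle (\<alpha> i) (\<alpha> j) (\<alpha> k) \<noteq> -1}"
      using angle_set[OF ij z] derived_angles[OF ij] by simp
    show "D i z = D j z \<or> D i z \<inter> D j z = {}"
      using equal[OF ij z z] by blast
    show "D i z = uminus ` D j z \<or> D i z \<inter> uminus ` D j z = {}"
      using opposite[OF ij z z] by blast
  qed (use kronecker strength triply in \<open>blast+\<close>)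
qed

end
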